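(* Suppose $\{\mathbf{W}_j\}_{j\in T_2}\subset \ell^2(\Lambda,\mathbb{C}^S)$ satisfies $$\big\|\mathcal{F}(E_{\frac{m}{M}}\mathbf{W}_j)(\xi)\big\|_{\mathbb{C}^S}\le B_0<\infty\quad\text{for } m\in T_1,\ j\in T_2,\ \text{a.e. }\xi\in\Omega,$$ where $B_0$ is a positive constant. For $m\in T_1$, $k\in\{1,\dots,S\}$ and a.e. $\xi\in[0,\frac1{4N})$ let $\mathcal{M}_{m,k}(\xi)$ be the $4N\times 2(P+1)$ matrix built from $\{\mathbf{W}_j\}_{j\in T_2}$ as defined in the context, and let $\mathcal{M}_{m,k}^*(\xi)$ be its conjugate transpose. Let $A_0>0$. Then $\mathcal{G}(\Lambda,T_1,T_2,\mathbf{W}_j)$ is a DVNUG frame for $\ell^2(\Lambda,\mathbb{C}^S)$ with lower frame bound $A_0$ if and only if $$\sum_{m\in T_1}\Big\|\sum_{k=1}^S\mathcal{M}_{m,k}^*(\xi)\mathbf{C}_k\Big\|_{\mathbb{C}^{2(P+1)}}^2\ \ge\ 4NA_0\sum_{k=1}^S\|\mathbf{C}_k\|_{\mathbb{C}^{4N}}^2\quad\text{for a.e. }\xi\in\Big(0,\frac1{4N}\Big),$$ for all $\mathbf{C}_k\in\mathbb{C}^{4N}$, $k=1,2,\dots,S$.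
   Context: Standing setting: $N,M,S\in\mathbb{N}$ (positive integers), $P\in\mathbb{N}\cup\{0\}$, $r$ is an odd integer coprime with $N$ with $1\le r\le 2N-1$, $\Lambda=\{0,\frac{r}{N}\}+2\mathbb{Z}$, $\Omega=[0,\frac12)\cup[\frac N2,\frac{N+1}{2})$, $T_1=\{0,1,\dots,M-1\}$, $T_2=\{0,1,\dots,P\}$. For $\mathbf{X}\in\mathbb{C}^n$, $[\mathbf{X}]_k$ is its $k$-th coordinate and $\|\mathbf{X}\|_{\mathbb{C}^n}$ its Euclidean norm. $\ell^2(\Lambda,\mathbb{C}^S)$ is the Hilbert space of families $\mathbf{Z}=\{\mathbf{Z}(\lambda)\}_{\lambda\in\Lambda}\subset\mathbb{C}^S$ with $\sum_{\lambda\in\Lambda}\sum_{k=1}^S|[\mathbf{Z}(\lambda)]_k|^2<\infty$, with inner product $\langle\mathbf{Z},\mathbf{W}\rangle=\sum_{\lambda\in\Lambda}\sum_{k=1}^S[\mathbf{Z}(\lambda)]_k\overline{[\mathbf{W}(\lambda)]_k}$ and induced norm $\|\cdot\|_{\ell^2}$. Operators on $\ell^2(\Lambda,\mathbb{C}^S)$: for $\lambda\in\Lambda$, $(R_{2N\lambda}\mathbf{Z})(\lambda')=\mathbf{Z}(\lambda'-2N\lambda)$, $\lambda'\in\Lambda$ (well defined since $2N\Lambda\subset 2\mathbb{Z}$); for $m\in T_1$, $(E_{\frac mM}\mathbf{Z})(\lambda')=e^{2\pi i\frac mM\lambda'}\mathbf{Z}(\lambda')$, $\lambda'\in\Lambda$.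 Fourier transform: $\mathcal{F}:\ell^2(\Lambda,\mathbb{C}^S)\to L^2(\Omega,\mathbb{C}^S)$, $[\mathcal{F}(\mathbf{Z})(\xi)]_k=\sum_{\lambda\in\Lambda}[\mathbf{Z}(\lambda)]_k e^{2\pi i\lambda\xi}$, $1\le k\le S$ (series convergent in $L^2(\Omega)$). $\mathcal{G}(\Lambda,T_1,T_2,\mathbf{W}_j)$ denotes the collection $\{E_{\frac mM}R_{2N\lambda}\mathbf{W}_j:\lambda\in\Lambda,\,m\in T_1,\,j\in T_2\}$ (the discrete vector-valued nonuniform Gabor system, DVNUG system, with window sequences $\mathbf{W}_j$). It is a DVNUG frame for $\ell^2(\Lambda,\mathbb{C}^S)$ with lower and upper frame bounds $\alpha,\beta$ ($0<\alpha\le\beta<\infty$) if $\alpha\|\mathbf{Z}\|_{\ell^2}^2\le\sum_{m\in T_1,\,j\in T_2,\,\lambda\in\Lambda}|\langle\mathbf{Z},E_{\frac mM}R_{2N\lambda}\mathbf{W}_j\rangle|^2\le\beta\|\mathbf{Z}\|_{\ell^2}^2$ for all $\mathbf{Z}\in\ell^2(\Lambda,\mathbb{C}^S)$. Matrices: for $m\in T_1$, $j\in T_2$, $k\in\{1,\dots,S\}$, $\xi\in[0,\frac1{4N})$, let $\mathcal{A}_{j,m,k}(\xi)$ and $\mathcal{B}_{j,m,k}(\xi)$ be the column vectors in $\mathbb{C}^{4N}$ with entries, for $t=0,1,\dots,2N-1$, $$[\mathcal{A}_{j,m,k}(\xi)]_{t+1}=\Big[\mathcal{F}(E_{\frac mM}\mathbf{W}_j)\big(\xi+\tfrac{t}{4N}\big)\Big]_k,\qquad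 [\mathcal{A}_{j,m,k}(\xi)]_{2N+t+1}=\Big[\mathcal{F}(E_{\frac mM}\mathbf{W}_j)\big(\xi+\tfrac N2+\tfrac{t}{4N}\big)\Big]_k,$$ $$[\mathcal{B}_{j,m,k}(\xi)]_{t+1}=e^{4\pi i r(\xi+\frac{t}{4N})}[\mathcal{A}_{j,m,k}(\xi)]_{t+1},\qquad [\mathcal{B}_{j,m,k}(\xi)]_{2N+t+1}=e^{4\pi i r(\xi+\frac{t}{4N})}[\mathcal{A}_{j,m,k}(\xi)]_{2N+t+1},$$ and let $$\mathcal{M}_{m,k}(\xi)=\begin{bmatrix}\mathcal{A}_{0,m,k}(\xi)&\mathcal{B}_{0,m,k}(\xi)&\mathcal{A}_{1,m,k}(\xi)&\mathcal{B}_{1,m,k}(\xi)&\cdots&\mathcal{A}_{P,m,k}(\xi)&\mathcal{B}_{P,m,k}(\xi)\end{bmatrix}_{4N\times 2(P+1)}.$$ *)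

theory Defs
  imports "HOL-Analysis.Analysis" "Jordan_Normal_Form.Schur_Decomposition"
begin

(* The fixed coordinate space of dimension S is complex^'s with S = CARD('s).  The spaces of
   dimensions 4N and 2(P+1), which depend on numerical parameters, are the carriers of complex
   vectors and matrices of the imported matrix library.  Both libraries write "$" for coordinates;
   here "$" is the latter one, and "$h" is used for complex^'s. *)

unbundle no vec_syntax
notation vec_nth (infixl "$h" 90)

definition cvec_norm :: "complex Matrix.vec \<Rightarrow> real" where
  "cvec_norm v = L2_set (\<lambda>i. cmod (v $ i)) {..<dim_vec v}"

definition Lam :: "nat \<Rightarrow> int \<Rightarrow> real set" where
  "Lam N r = {x + 2 * of_int n | x n. x \<in> {0, of_int r / of_nat N}}"

definition Omega :: "nat \<Rightarrow> real set" where
  "Omega N = {0..<1/2} \<union> {of_nat N / 2..<(of_nat N + 1) / 2}"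

(* A family indexed by a set L of reals is represented by any function on the reals; its values
   outside L are never used. *)

definition ell2 :: "real set \<Rightarrow> (real \<Rightarrow> complex^'s) set" where
  "ell2 L = {Z. (\<lambda>l. \<Sum>k\<in>UNIV. (cmod (Z l $h k))\<^sup>2) summable_on L}"

definition ell2_inner :: "real set \<Rightarrow> (real \<Rightarrow> complex^'s) \<Rightarrow> (real \<Rightarrow> complex^'s) \<Rightarrow> complex" where
  "ell2_inner L Z W = (\<Sum>\<^sub>\<infinity>l\<in>L. \<Sum>k\<in>UNIV. Z l $h k * cnj (W l $h k))"

definition ell2_norm :: "real set \<Rightarrow> (real \<Rightarrow> complex^'s) \<Rightarrow> real" where
  "ell2_norm L Z = sqrt (Re (ell2_inner L Z Z))"

definition shift_op :: "real \<Rightarrow> (real \<Rightarrow> complex^'s) \<Rightarrow> real \<Rightarrow> complex^'s" where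
  "shift_op a Z = (\<lambda>l. Z (l - a))"

definition modulation_op :: "real \<Rightarrow> (real \<Rightarrow> complex^'s) \<Rightarrow> real \<Rightarrow> complex^'s" where
  "modulation_op a Z = (\<lambda>l. cis (2 * pi * a * l) *s Z l)"

(* The Fourier transform is the sum of the series in L^2(Om), i.e. the limit of the net of its
   finite partial sums.  It is determined almost everywhere; a Borel representative is chosen. *)

definition fourier :: "real set \<Rightarrow> real set \<Rightarrow> (real \<Rightarrow> complex^'s) \<Rightarrow> real \<Rightarrow> complex^'s" where
  "fourier L Om Z = (SOME f. f \<in> borel_measurable lborel \<and>
     (\<integral>\<^sup>+\<xi>\<in>Om. ennreal ((norm (f \<xi>))\<^sup>2) \<partial>lborel) < \<infinity> \<and>
     ((\<lambda>F. \<integral>\<^sup>+\<xi>\<in>Om. ennreal ((norm (f \<xi> - (\<Sum>l\<in>F. cis (2 * pi * l * \<xi>) *s Z l)))\<^sup>2) \<partial>lborel)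
        \<longlongrightarrow> 0) (finite_subsets_at_top L))"

definition gabor_elem ::
  "nat \<Rightarrow> nat \<Rightarrow> (nat \<Rightarrow> real \<Rightarrow> complex^'s) \<Rightarrow> nat \<Rightarrow> nat \<Rightarrow> real \<Rightarrow> real \<Rightarrow> complex^'s" where
  "gabor_elem N M W m j l = modulation_op (of_nat m / of_nat M) (shift_op (2 * of_nat N * l) (W j))"

(* Summability is stated explicitly because infsum is 0 on families that are not summable. *)

definition dvnug_frame ::
  "nat \<Rightarrow> int \<Rightarrow> nat \<Rightarrow> nat \<Rightarrow> (nat \<Rightarrow> real \<Rightarrow> complex^'s) \<Rightarrow> real \<Rightarrow> real \<Rightarrow> bool" where
  "dvnug_frame N r M P W \<alpha> \<beta> \<longleftrightarrow> 0 < \<alpha> \<and> \<alpha> \<le> \<beta> \<and>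
     (\<forall>Z\<in>ell2 (Lam N r).
        (\<lambda>(m, j, l). (cmod (ell2_inner (Lam N r) Z (gabor_elem N M W m j l)))\<^sup>2)
          summable_on {..<M} \<times> {..P} \<times> Lam N r \<and>
        \<alpha> * (ell2_norm (Lam N r) Z)\<^sup>2
          \<le> (\<Sum>\<^sub>\<infinity>(m, j, l)\<in>{..<M} \<times> {..P} \<times> Lam N r.
               (cmod (ell2_inner (Lam N r) Z (gabor_elem N M W m j l)))\<^sup>2) \<and>
        (\<Sum>\<^sub>\<infinity>(m, j, l)\<in>{..<M} \<times> {..P} \<times> Lam N r.
               (cmod (ell2_inner (Lam N r) Z (gabor_elem N M W m j l)))\<^sup>2)
          \<le> \<beta> * (ell2_norm (Lam N r) Z)\<^sup>2)"

definition colA ::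
  "nat \<Rightarrow> int \<Rightarrow> nat \<Rightarrow> (nat \<Rightarrow> real \<Rightarrow> complex^'s) \<Rightarrow> nat \<Rightarrow> nat \<Rightarrow> 's \<Rightarrow> real \<Rightarrow> complex Matrix.vec"
where
  "colA N r M W j m k \<xi> =
     (let F = fourier (Lam N r) (Omega N) (modulation_op (of_nat m / of_nat M) (W j)) in
      Matrix.vec (2 * N) (\<lambda>t. F (\<xi> + of_nat t / (4 * of_nat N)) $h k) @\<^sub>v
      Matrix.vec (2 * N) (\<lambda>t. F (\<xi> + of_nat N / 2 + of_nat t / (4 * of_nat N)) $h k))"

definition colB ::
  "nat \<Rightarrow> int \<Rightarrow> nat \<Rightarrow> (nat \<Rightarrow> real \<Rightarrow> complex^'s) \<Rightarrow> nat \<Rightarrow> nat \<Rightarrow> 's \<Rightarrow> real \<Rightarrow> complex Matrix.vec"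
where
  "colB N r M W j m k \<xi> =
     (let A = colA N r M W j m k \<xi>;
          e = (\<lambda>t::nat. cis (4 * pi * of_int r * (\<xi> + of_nat t / (4 * of_nat N)))) in
      Matrix.vec (2 * N) (\<lambda>t. e t * A $ t) @\<^sub>v
      Matrix.vec (2 * N) (\<lambda>t. e t * A $ (2 * N + t)))"

definition matM ::
  "nat \<Rightarrow> int \<Rightarrow> nat \<Rightarrow> nat \<Rightarrow> (nat \<Rightarrow> real \<Rightarrow> complex^'s) \<Rightarrow> nat \<Rightarrow> 's \<Rightarrow> real \<Rightarrow> complex Matrix.mat"
where
  "matM N r M P W m k \<xi> =
     mat_of_cols (4 * N)
       (concat (map (\<lambda>j. [colA N r M W j m k \<xi>, colB N r M W j m k \<xi>]) [0..<P + 1]))"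

end

theory Submission
  imports Defs
begin

text \<open>
  The exponentials with frequencies in \<open>Lam N r\<close> form an orthonormal basis of \<open>L\<^sup>2(Omega N)\<close>, so the Fourier
  transform is unitary.  It turns translations into modulations by \<open>exp (2 \<pi> i (2 N l) x)\<close>; for \<open>l = 2n\<close> these are
  \<open>1/(4N)\<close>-periodic on the grid of shifts that tile \<open>Omega N\<close> by \<open>[0, 1/(4N))\<close>, and for \<open>l = r/N + 2n\<close> they are
  periodic up to the factor \<open>exp (4 \<pi> i r x)\<close>.  Parseval's identity on \<open>[0, 1/(4N))\<close> then shows that the frame sum of \<open>Z\<close> is
  \<open>1/(4N)\<close> times the integral of the sums of squares of the entries of the vectors \<open>\<Sum>k M(x)\<^sup>* C\<^sub>k(x)\<close>, where \<open>C\<^sub>k(x)\<close> lists the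
  values of the \<open>k\<close>-th component of the Fourier transform of \<open>Z\<close> at the shifts of \<open>x\<close>.  Since \<open>C\<close> may be any square
  integrable function, the integrated inequality is equivalent to the pointwise one; the upper frame
  bound is automatic from the boundedness of the Fourier transforms of the windows.
\<close>

section \<open>Uniqueness of Fourier coefficients on an interval\<close>

text \<open>Three difficulties shape the argument. In the matrix inequality the vectors
  \<open>C k\<close> are fixed before "almost every x", so the null set may depend on them, whereas
  the frame inequality for \<open>Z\<close> inserts coefficients that vary with x. One null set for
  all coefficients exists because both sides are continuous in finitely many complex entries. Next,
  the matrices contain transforms of modulated windows, while the system consists of modulated
  translates: modulation and translation commute up to a factor of modulus 1, which the absolute
  values discard. Finally, \<open>fourier\<close> picks some representative of an L^2 limit, so all
  that is derived about it is measurability and the relation \<open>represents\<close>. Completeness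
  of the exponentials on an interval is an approximation argument on the unit circle: vanishing
  moments pass to polynomials, continuous functions, closed arcs and then Borel sets. The factor 4N
  stems from Parseval's identity for exponentials of modulus 1 on an interval of length 1/(4N), set
  against an orthonormal system on \<open>Omega N\<close>.\<close>

text \<open>If all trigonometric moments of \<open>F\<close> vanish then so do those of \<open>F\<close> times a polynomial in \<open>u\<close>:
  in this form the claim is stable under products, hence provable by induction on the polynomial.\<close>

lemma powi_poly_moments:
  fixes u F :: "'a \<Rightarrow> complex" and p :: "complex \<Rightarrow> real"
  assumes [measurable]: "u \<in> borel_measurable M" and u1: "\<And>x. cmod (u x) = 1"
    and "real_polynomial_function p" and "integrable M F"
    and "\<And>n::int. (\<integral>x. F x * u x powi n \<partial>M) = 0"
  shows "integrable M (\<lambda>x. F x * of_real (p (u x))) \<and>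
    (\<forall>n::int. (\<integral>x. F x * of_real (p (u x)) * u x powi n \<partial>M) = 0)"
  using assms(3-5)
proof (induction p arbitrary: F rule: real_polynomial_function.induct)
  case (linear f)
  note [measurable] = borel_measurable_integrable[OF linear(2)]
  define a b where "a = f 1" and "b = f \<i>"
  have u0: "u x \<noteq> 0" for x using u1[of x] by auto
  have lin: "f z = a * Re z + b * Im z" for z
  proof -
    interpret bounded_linear f by (rule linear)
    have "f z = f (Re z *\<^sub>R 1 + Im z *\<^sub>R \<i>)"
      by (rule arg_cong[where f=f]) (simp add: complex_eq_iff)
    then show ?thesis by (simp add: add scaleR a_def b_def mult.commute)
  qed
  \<comment> \<open>On the unit circle the conjugate of z is its inverse, so a Re z + b Im z equals
    \<alpha> z + \<beta> z^-1; multiplying \<open>F\<close> by it only shifts moments.\<close>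
  define \<alpha> \<beta> where "\<alpha> = Complex (a/2) (-b/2)" and "\<beta> = Complex (a/2) (b/2)"
  have rep: "of_real (f (u x)) = \<alpha> * u x powi 1 + \<beta> * u x powi (-1)" for x
  proof -
    have "inverse (u x) = cnj (u x)" using u1[of x]
      by (metis complex_div_cnj divide_inverse div_by_1 inverse_eq_divide mult_1 norm_one of_real_1 power_one)
    then have "u x powi (-1) = cnj (u x)" by (simp add: power_int_minus)
    then show ?thesis
      by (simp only:) (simp add: lin \<alpha>_def \<beta>_def complex_eq_iff)
  qed
  have n1: "cmod (u x powi n) = 1" for x n by (simp add: norm_power_int u1)
  have um: "(\<lambda>x. u x powi n) \<in> borel_measurable M" for n
    unfolding power_int_def by measurable
  have ints: "integrable M (\<lambda>x. F x * u x powi n)" for n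
    by (rule Bochner_Integration.integrable_bound[OF linear(2)])
      (use um in \<open>auto simp: norm_mult n1\<close>)
  have eq: "F x * of_real (f (u x)) * u x powi n = \<alpha> * (F x * u x powi (n+1)) + \<beta> * (F x * u x powi (n-1))" for x n
    unfolding rep using u0[of x] by (simp add: power_int_add power_int_diff power_int_minus field_simps)
  have "integrable M (\<lambda>x. \<alpha> * (F x * u x powi (0+1)) + \<beta> * (F x * u x powi (0-1)))"
    by (intro Bochner_Integration.integrable_add integrable_mult_right ints)
  moreover have "(\<integral>x. F x * of_real (f (u x)) * u x powi n \<partial>M) = 0" for n
    unfolding eq by (simp add: linear(3) ints)
  ultimately show ?case
    using eq[of _ 0] by simp
next
  case (add f g)
  have um: "(\<lambda>x. u x powi n) \<in> borel_measurable M" for n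
    unfolding power_int_def by measurable
  have f: "integrable M (\<lambda>x. F x * of_real (f (u x)))" "\<And>n::int. (\<integral>x. F x * of_real (f (u x)) * u x powi n \<partial>M) = 0"
    using add.IH(1)[OF add.prems] by auto
  have g: "integrable M (\<lambda>x. F x * of_real (g (u x)))" "\<And>n::int. (\<integral>x. F x * of_real (g (u x)) * u x powi n \<partial>M) = 0"
    using add.IH(2)[OF add.prems] by auto
  have n1: "cmod (u x powi n) = 1" for x n by (simp add: norm_power_int u1)
  have "integrable M (\<lambda>x. G x * u x powi n)" if "integrable M G" for G n
    by (rule Bochner_Integration.integrable_bound[OF that])
      (use um that in \<open>auto simp: norm_mult n1\<close>)
  note fi = this[OF f(1)] and gi = this[OF g(1)]
  show ?case using f g fi gi by (simp add: distrib_left distrib_right)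
next
  case (mult f g)
  have f: "integrable M (\<lambda>x. F x * of_real (f (u x)))" "\<And>n::int. (\<integral>x. F x * of_real (f (u x)) * u x powi n \<partial>M) = 0"
    using mult.IH(1)[OF mult.prems] by auto
  show ?case using mult.IH(2)[OF f] by (simp add: mult_ac)
next
  case (const c)
  have eq: "F x * of_real c * u x powi n = of_real c * (F x * u x powi n)" for x n by simp
  show ?case unfolding eq using const by simp
qed

text \<open>By Stone-Weierstrass on the circle, vanishing against polynomials gives vanishing
  against continuous functions of \<open>u\<close>; cutoffs decreasing to the indicator of
  \<open>K\<close> and dominated convergence then reach closed sets.\<close>

lemma powi_closed_moments:
  fixes u F :: "'a \<Rightarrow> complex" and K :: "complex set"
  assumes [measurable]: "u \<in> borel_measurable M" and u1: "\<And>x. cmod (u x) = 1"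
    and F: "integrable M F" and F0: "\<And>n::int. (\<integral>x. F x * u x powi n \<partial>M) = 0"
    and K: "closed K"
  shows "(\<integral>x. indicator K (u x) *\<^sub>R F x \<partial>M) = 0"
proof (cases "K = {}")
  case False
  have [measurable]: "F \<in> borel_measurable M" using F by auto
  have cont: "(\<integral>x. F x * of_real (\<phi> (u x)) \<partial>M) = 0" if \<phi>: "continuous_on UNIV \<phi>" for \<phi>
  proof -
    have [measurable]: "\<phi> \<in> borel_measurable borel" using \<phi> by (rule borel_measurable_continuous_onI)
    have "cmod (\<integral>x. F x * of_real (\<phi> (u x)) \<partial>M) \<le> e * (\<integral>x. cmod (F x) \<partial>M)" if e: "e > 0" for e
    proof -
      have "compact (sphere 0 1 :: complex set)" by simp
      from Stone_Weierstrass_real_polynomial_function[OF this continuous_on_subset[OF \<phi>] e]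
      obtain p where p: "real_polynomial_function p" and pe: "\<And>z. z \<in> sphere 0 1 \<Longrightarrow> \<bar>\<phi> z - p z\<bar> < e"
        by auto
      have [measurable]: "p \<in> borel_measurable borel"
        using p continuous_real_polymonial_function by (blast intro: borel_measurable_continuous_onI continuous_at_imp_continuous_on)
      have pm: "integrable M (\<lambda>x. F x * of_real (p (u x)))" "(\<integral>x. F x * of_real (p (u x)) \<partial>M) = 0"
        using powi_poly_moments[OF _ u1 p F F0] by (auto dest: spec[of _ 0])
      have bd: "norm (F x * of_real (\<phi> (u x) - p (u x))) \<le> norm (e * cmod (F x))" for x
        using mult_left_mono[OF less_imp_le[OF pe[of "u x"]] norm_ge_zero[of "F x"]] u1[of x] e
        by (simp add: norm_mult mult.commute flip: of_real_diff)
      have d: "integrable M (\<lambda>x. F x * of_real (\<phi> (u x) - p (u x)))"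
        by (rule Bochner_Integration.integrable_bound[where f="\<lambda>x. e * cmod (F x)"])
          (use bd F in auto)
      have "(\<integral>x. F x * of_real (\<phi> (u x)) \<partial>M) = (\<integral>x. F x * of_real (\<phi> (u x) - p (u x)) + F x * of_real (p (u x)) \<partial>M)"
        by (intro Bochner_Integration.integral_cong) (auto simp: algebra_simps)
      also have "\<dots> = (\<integral>x. F x * of_real (\<phi> (u x) - p (u x)) \<partial>M)"
        using d pm by simp
      finally have "cmod (\<integral>x. F x * of_real (\<phi> (u x)) \<partial>M) \<le> (\<integral>x. norm (F x * of_real (\<phi> (u x) - p (u x))) \<partial>M)"
        by simp
      also have "\<dots> \<le> (\<integral>x. e * cmod (F x) \<partial>M)"
        using d bd F e by (intro integral_mono) auto
      finally show ?thesis by simp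
    qed
    note le = this
    define I where "I = (\<integral>x. cmod (F x) \<partial>M)"
    have "I \<ge> 0" by (simp add: I_def)
    have "cmod (\<integral>x. F x * of_real (\<phi> (u x)) \<partial>M) \<le> 0 + e" if "e > 0" for e
    proof -
      \<comment> \<open>The denominator \<open>I + 1\<close> avoids division by zero when
        \<open>F\<close> is 0 almost everywhere.\<close>
      have "cmod (\<integral>x. F x * of_real (\<phi> (u x)) \<partial>M) \<le> e / (I + 1) * I"
        using le[of "e / (I + 1)"] that \<open>I \<ge> 0\<close> unfolding I_def[symmetric] by simp
      also have "\<dots> \<le> e" using that \<open>I \<ge> 0\<close> by (simp add: field_simps)
      finally show ?thesis by simp
    qed
    then have "cmod (\<integral>x. F x * of_real (\<phi> (u x)) \<partial>M) \<le> 0" by (rule field_le_epsilon)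
    then show ?thesis by simp
  qed
  \<comment> \<open>Outside a closed nonempty \<open>K\<close> the distance to \<open>K\<close> is
    positive, so these cutoffs are eventually 0 there. The empty set is treated apart because
    \<open>infdist\<close> to it is 0 by convention.\<close>
  define \<phi> where "\<phi> n z = max 0 (1 - real n * infdist z K)" for n z
  have \<phi>c: "continuous_on UNIV (\<phi> n)" for n
    unfolding \<phi>_def by (intro continuous_intros)
  have [measurable]: "\<phi> n \<in> borel_measurable borel" for n
    using \<phi>c by (rule borel_measurable_continuous_onI)
  have lim: "(\<lambda>n. \<phi> n z) \<longlonglongrightarrow> indicator K z" for z
  proof (cases "z \<in> K")
    case True
    then show ?thesis by (simp add: \<phi>_def)
  next
    case nz: False
    define d where "d = infdist z K"
    have "d > 0" using in_closed_iff_infdist_zero[OF K False] nz infdist_nonneg[of z K] by (force simp: d_def)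
    obtain n0 where n0: "1 < real n0 * d" using reals_Archimedean3[OF \<open>d > 0\<close>] by blast
    have "\<phi> n z = 0" if "n \<ge> n0" for n
    proof -
      have "real n0 * d \<le> real n * d" using that \<open>d > 0\<close> by simp
      then show ?thesis using n0 by (simp add: \<phi>_def flip: d_def)
    qed
    then show ?thesis using nz
      by (intro tendsto_eventually) (auto simp: eventually_sequentially)
  qed
  have [measurable]: "K \<in> sets borel" using K by auto
  have "(\<lambda>n. \<integral>x. F x * of_real (\<phi> n (u x)) \<partial>M) \<longlonglongrightarrow> (\<integral>x. indicator K (u x) *\<^sub>R F x \<partial>M)"
  proof (rule integral_dominated_convergence[where w="\<lambda>x. cmod (F x)"])
    show "AE x in M. (\<lambda>n. F x * of_real (\<phi> n (u x))) \<longlonglongrightarrow> indicator K (u x) *\<^sub>R F x"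
      using lim by (auto intro!: AE_I2 tendsto_intros simp: scaleR_conv_of_real mult.commute)
    show "AE x in M. cmod (F x * of_real (\<phi> n (u x))) \<le> cmod (F x)" for n
      by (intro AE_I2) (auto simp: norm_mult \<phi>_def infdist_nonneg intro!: mult_left_le)
  qed (use F in auto)
  then have "(\<lambda>n::nat. 0::complex) \<longlonglongrightarrow> (\<integral>x. indicator K (u x) *\<^sub>R F x \<partial>M)"
    using cont[OF \<phi>c] by simp
  then show ?thesis by (metis LIMSEQ_const_iff)
qed simp

text \<open>Each segment [0, a] of [0, L) is the preimage of a closed arc, so the integral of
  \<open>F\<close> over it vanishes. Such integrals determine those over all Borel sets, and an
  integrable function whose set integrals all vanish is 0 almost everywhere.\<close>

lemma fourier_uniqueness_interval:
  fixes F :: "real \<Rightarrow> complex"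
  assumes L: "L > 0" and F: "integrable (restrict_space lborel {0..<L}) F"
    and F0: "\<And>n::int. (\<integral>x. F x * cis (2 * pi * of_int n * x / L) \<partial>restrict_space lborel {0..<L}) = 0"
  shows "AE x in restrict_space lborel {0..<L}. F x = 0"
proof -
  define M where "M = restrict_space lborel {0..<L}"
  define G where "G = (\<lambda>x. indicator {0..<L} x *\<^sub>R F x)"
  define u where "u = (\<lambda>x::real. cis (2 * pi * x / L))"
  have GI: "integrable lborel G" using F by (simp add: integrable_restrict_space G_def)
  have u_cont: "continuous_on A u" for A
    unfolding u_def using L by (intro continuous_intros) auto
  then have u_meas: "u \<in> borel_measurable lborel"
    using borel_measurable_continuous_onI[of u] by simp
  have G0: "(\<integral>x. G x * u x powi n \<partial>lborel) = 0" for n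
  proof -
    have "u x powi n = cis (2 * pi * of_int n * x / L)" for x
      by (simp add: u_def cis_power_int field_simps)
    then show ?thesis using F0[of n] by (simp add: G_def integral_restrict_space)
  qed
  have int_at: "set_lebesgue_integral lborel {..a} G = 0" for a
  proof (cases "0 \<le> a \<and> a < L")
    case True
    define K where "K = u ` {0..a}"
    have K: "closed K" unfolding K_def
      by (intro compact_imp_closed compact_continuous_image u_cont) auto
    \<comment> \<open>Two points of the half-open interval with the same image under
      \<open>u\<close> differ by a multiple of \<open>L\<close> smaller than \<open>L\<close> in
      absolute value, hence coincide.\<close>
    have inK: "u x \<in> K \<longleftrightarrow> x \<le> a" if "x \<in> {0..<L}" for x
    proof
      assume "u x \<in> K"
      then obtain y where y: "0 \<le> y" "y \<le> a" "u x = u y" by (auto simp: K_def)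
      from y(3) have "sin (2 * pi * x / L) = sin (2 * pi * y / L) \<and> cos (2 * pi * x / L) = cos (2 * pi * y / L)"
        by (simp add: u_def cis.ctr complex_eq_iff)
      then obtain n::int where "2 * pi * x / L = 2 * pi * y / L + 2 * pi * n"
        using sin_cos_eq_iff by blast
      then have "2 * pi * x = 2 * pi * (y + L * n)" using L by (simp add: field_simps)
      then have xy: "x = y + L * n" by simp
      have "\<bar>x - y\<bar> < L" using that y True by auto
      then have "L * \<bar>real_of_int n\<bar> < L * 1" using xy L by (simp add: abs_mult)
      then have "\<bar>real_of_int n\<bar> < 1" using L mult_less_cancel_left_pos by blast
      then have "n = 0" by linarith
      then show "x \<le> a" using xy y by simp
    next
      assume "x \<le> a"
      then show "u x \<in> K" using that by (auto simp: K_def)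
    qed
    have "set_lebesgue_integral lborel {..a} G = (\<integral>x. indicator K (u x) *\<^sub>R G x \<partial>lborel)"
      unfolding set_lebesgue_integral_def
      by (intro Bochner_Integration.integral_cong) (auto simp: G_def indicator_def inK)
    also have "\<dots> = 0"
      by (rule powi_closed_moments[OF u_meas _ GI G0 K]) (auto simp: u_def)
    finally show ?thesis .
  next
    case False
    show ?thesis
    proof (cases "a < 0")
      case True
      then have "(\<lambda>x. indicat_real {..a} x *\<^sub>R G x) = (\<lambda>x. 0)"
        by (auto simp: G_def indicator_def)
      then show ?thesis by (simp add: set_lebesgue_integral_def)
    next
      case False': False
      \<comment> \<open>Here the half-line contains the whole interval, and its integral is the
        moment n = 0.\<close>
      then have "(\<lambda>x. indicat_real {..a} x *\<^sub>R G x) = (\<lambda>x. G x * u x powi 0)"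
        using False by (auto simp: G_def indicator_def)
      then show ?thesis using G0[of 0] by (simp add: set_lebesgue_integral_def)
    qed
  qed
  have si: "set_integrable lborel A G" if "A \<in> sets borel" for A
    using GI that unfolding set_integrable_def by (intro integrable_mult_indicator) auto
  have int0: "(LINT x|lborel. G x) = 0" using G0[of 0] by simp
  \<comment> \<open>Dynkin's argument: half-lines are stable under intersection, and complements are
    harmless because the total integral is 0.\<close>
  have all0: "set_lebesgue_integral lborel A G = 0" if "A \<in> sets borel" for A
  proof -
    have "Int_stable (range (\<lambda>a::real. {..a}))"
      by (auto simp: Int_stable_def)
    moreover have "range (\<lambda>a::real. {..a}) \<subseteq> Pow UNIV" by auto
    moreover have "A \<in> sigma_sets UNIV (range (\<lambda>a::real. {..a}))"
      using that unfolding borel_eq_atMost by simp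
    ultimately show ?thesis
    proof (induction A rule: sigma_sets_induct_disjoint)
      case (basic A)
      then show ?case using int_at by auto
    next
      case empty
      show ?case by (simp add: set_lebesgue_integral_def)
    next
      case (compl A)
      then have A: "A \<in> sets borel" unfolding borel_eq_atMost by simp
      have "set_lebesgue_integral lborel (A \<union> (UNIV - A)) G
         = set_lebesgue_integral lborel A G + set_lebesgue_integral lborel (UNIV - A) G"
        using A by (intro set_integral_Un si) auto
      then show ?case using compl int0 by (simp add: set_lebesgue_integral_def)
    next
      case (union A)
      then have A: "A i \<in> sets borel" for i unfolding borel_eq_atMost by auto
      have "set_lebesgue_integral lborel (\<Union>i. A i) G = (\<Sum>i. set_lebesgue_integral lborel (A i) G)"
        using A union by (intro lebesgue_integral_countable_add si) (auto simp: disjoint_family_on_def)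
      then show ?case using union by simp
    qed
  qed
  have "AE x in lborel. G x = 0"
    by (rule sigma_finite_measure.density_zero[OF lborel.sigma_finite_measure_axioms GI]) (use all0 in auto)
  then show ?thesis
    by (subst AE_restrict_space_iff) (auto simp: G_def elim!: eventually_mono)
qed

section \<open>Square-integrable functions and orthonormal bases\<close>

definition sq_integrable :: "'a measure \<Rightarrow> ('a \<Rightarrow> complex) \<Rightarrow> bool" where
  "sq_integrable M f \<longleftrightarrow> f \<in> borel_measurable M \<and> integrable M (\<lambda>x. (cmod (f x))\<^sup>2)"

lemma sq_integrable_zero [simp]: "sq_integrable M (\<lambda>x. 0)"
  by (simp add: sq_integrable_def)

lemma sq_integrable_add:
  assumes "sq_integrable M f" "sq_integrable M g"
  shows "sq_integrable M (\<lambda>x. f x + g x)"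
proof -
  have [measurable]: "f \<in> borel_measurable M" "g \<in> borel_measurable M"
    using assms by (auto simp: sq_integrable_def)
  have "(cmod (a + b))\<^sup>2 \<le> 2 * (cmod a)\<^sup>2 + 2 * (cmod b)\<^sup>2" for a b :: complex
  proof -
    have "(cmod (a + b))\<^sup>2 \<le> (cmod a + cmod b)\<^sup>2" by (intro power_mono norm_triangle_ineq) auto
    also have "\<dots> \<le> 2 * (cmod a)\<^sup>2 + 2 * (cmod b)\<^sup>2"
      using zero_le_power2[of "cmod a - cmod b"] by (simp add: power2_eq_square algebra_simps)
    finally show ?thesis .
  qed
  then have "integrable M (\<lambda>x. (cmod (f x + g x))\<^sup>2)"
    by - (rule Bochner_Integration.integrable_bound[of M "\<lambda>x. 2 * (cmod (f x))\<^sup>2 + 2 * (cmod (g x))\<^sup>2"],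
      use assms in \<open>auto simp: sq_integrable_def\<close>)
  then show ?thesis by (simp add: sq_integrable_def)
qed

lemma sq_integrable_mult_bounded:
  assumes "sq_integrable M f" and [measurable]: "h \<in> borel_measurable M"
    and "AE x in M. cmod (h x) \<le> K"
  shows "sq_integrable M (\<lambda>x. h x * f x)"
proof -
  have [measurable]: "f \<in> borel_measurable M" using assms by (auto simp: sq_integrable_def)
  have "AE x in M. norm ((cmod (h x * f x))\<^sup>2) \<le> norm (K\<^sup>2 * (cmod (f x))\<^sup>2)"
    using assms(3) by eventually_elim (auto simp: norm_mult power_mult_distrib intro!: mult_right_mono power_mono)
  then have "integrable M (\<lambda>x. (cmod (h x * f x))\<^sup>2)"
    by - (rule Bochner_Integration.integrable_bound[of M "\<lambda>x. K\<^sup>2 * (cmod (f x))\<^sup>2"],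
      use assms in \<open>auto simp: sq_integrable_def\<close>)
  then show ?thesis by (simp add: sq_integrable_def)
qed

lemma sq_integrable_cmult: "sq_integrable M f \<Longrightarrow> sq_integrable M (\<lambda>x. c * f x)"
  by (rule sq_integrable_mult_bounded[where K="cmod c"]) auto

lemma sq_integrable_diff:
  assumes "sq_integrable M f" "sq_integrable M g"
  shows "sq_integrable M (\<lambda>x. f x - g x)"
  using sq_integrable_add[OF assms(1) sq_integrable_cmult[OF assms(2), of "-1"]] by simp

lemma sq_integrable_sum:
  "(\<And>i. i \<in> A \<Longrightarrow> sq_integrable M (f i)) \<Longrightarrow> sq_integrable M (\<lambda>x. \<Sum>i\<in>A. f i x)"
  by (induction A rule: infinite_finite_induct) (auto intro: sq_integrable_add)

lemma borel_measurable_cnj [measurable]: "cnj \<in> borel_measurable borel"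
  by (intro borel_measurable_continuous_onI continuous_intros)

lemma sq_integrable_inner:
  assumes "sq_integrable M f" "sq_integrable M g"
  shows "integrable M (\<lambda>x. f x * cnj (g x))"
proof -
  have [measurable]: "f \<in> borel_measurable M" "g \<in> borel_measurable M"
    using assms by (auto simp: sq_integrable_def)
  have "cmod a * cmod b \<le> (cmod a)\<^sup>2 + (cmod b)\<^sup>2" for a b :: complex
    using sum_squares_bound[of "cmod a" "cmod b"] mult_nonneg_nonneg[OF norm_ge_zero[of a] norm_ge_zero[of b]]
    by linarith
  moreover have "(\<lambda>x. f x * cnj (g x)) \<in> borel_measurable M" by measurable
  ultimately show ?thesis
    by - (rule Bochner_Integration.integrable_bound[of M "\<lambda>x. (cmod (f x))\<^sup>2 + (cmod (g x))\<^sup>2"],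
      use assms in \<open>auto simp: sq_integrable_def norm_mult\<close>)
qed

lemma (in finite_measure) sq_integrable_integrable:
  assumes "sq_integrable M f"
  shows "integrable M f"
proof -
  have "sq_integrable M (\<lambda>x. 1)" by (simp add: sq_integrable_def)
  from sq_integrable_inner[OF assms this] show ?thesis by simp
qed

lemma cauchy_schwarz_integral:
  assumes f: "sq_integrable M f" and g: "sq_integrable M g"
  shows "(cmod (\<integral>x. f x * cnj (g x) \<partial>M))\<^sup>2 \<le> (\<integral>x. (cmod (f x))\<^sup>2 \<partial>M) * (\<integral>x. (cmod (g x))\<^sup>2 \<partial>M)"
proof -
  define A B C where "A = (\<integral>x. (cmod (f x))\<^sup>2 \<partial>M)" and "B = (\<integral>x. (cmod (g x))\<^sup>2 \<partial>M)"
    and "C = (\<integral>x. cmod (f x) * cmod (g x) \<partial>M)"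
  have fi: "integrable M (\<lambda>x. (cmod (f x))\<^sup>2)" and gi: "integrable M (\<lambda>x. (cmod (g x))\<^sup>2)"
    using f g by (auto simp: sq_integrable_def)
  have fg: "integrable M (\<lambda>x. cmod (f x) * cmod (g x))"
    using integrable_norm[OF sq_integrable_inner[OF f g]] by (simp add: norm_mult)
  \<comment> \<open>A quadratic in t that is never negative: it is used at its minimum
    \<open>C / B\<close>, or, if \<open>B = 0\<close>, at a point where the remaining linear
    expression would equal -1.\<close>
  have quad: "0 \<le> A - 2 * t * C + t\<^sup>2 * B" for t
  proof -
    have "0 \<le> (\<integral>x. (cmod (f x) - t * cmod (g x))\<^sup>2 \<partial>M)" by simp
    also have "\<dots> = (\<integral>x. (cmod (f x))\<^sup>2 - 2 * t * (cmod (f x) * cmod (g x)) + t\<^sup>2 * (cmod (g x))\<^sup>2 \<partial>M)"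
      by (intro Bochner_Integration.integral_cong) (auto simp: power2_eq_square algebra_simps)
    also have "\<dots> = A - 2 * t * C + t\<^sup>2 * B"
      using fi gi fg by (simp add: A_def B_def C_def)
    finally show ?thesis .
  qed
  have A0: "A \<ge> 0" and B0: "B \<ge> 0" and C0: "C \<ge> 0" by (auto simp: A_def B_def C_def)
  have "C\<^sup>2 \<le> A * B"
  proof (cases "B = 0")
    case True
    have "C = 0"
    proof (rule ccontr)
      assume "C \<noteq> 0"
      with quad[of "(A + 1) / (2 * C)"] True show False by simp
    qed
    then show ?thesis using A0 B0 by simp
  next
    case False
    then have "B > 0" using B0 by simp
    have "0 \<le> A - C\<^sup>2 / B"
      using quad[of "C / B"] \<open>B > 0\<close> by (simp add: power2_eq_square)
    then show ?thesis using \<open>B > 0\<close> by (simp add: field_simps)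
  qed
  moreover have "cmod (\<integral>x. f x * cnj (g x) \<partial>M) \<le> C"
    using integral_norm_bound[of M "\<lambda>x. f x * cnj (g x)"] by (simp add: C_def norm_mult)
  then have "(cmod (\<integral>x. f x * cnj (g x) \<partial>M))\<^sup>2 \<le> C\<^sup>2" by (intro power_mono) auto
  ultimately show ?thesis by (simp add: A_def B_def)
qed

section \<open>Orthonormal bases of L^2: Riesz-Fischer and Parseval\<close>

lemma cmod_power2_complex: "complex_of_real ((cmod z)\<^sup>2) = z * cnj z"
  using complex_norm_square[of z] by simp

text \<open>Completeness is demanded in the dual form, that only 0 is orthogonal to every
  \<open>e l\<close>, since this is what vanishing moments deliver; convergence of expansions is
  recovered in \<open>represents_expansion\<close>.\<close>

locale orthonormal_basis =
  fixes M :: "'a measure" and e :: "'i \<Rightarrow> 'a \<Rightarrow> complex" and I :: "'i set"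
  assumes e_sq: "l \<in> I \<Longrightarrow> sq_integrable M (e l)"
    and orth: "l \<in> I \<Longrightarrow> l' \<in> I \<Longrightarrow> (\<integral>x. e l x * cnj (e l' x) \<partial>M) = of_bool (l = l')"
    and total: "sq_integrable M f \<Longrightarrow> (\<And>l. l \<in> I \<Longrightarrow> (\<integral>x. f x * cnj (e l x) \<partial>M) = 0) \<Longrightarrow> AE x in M. f x = 0"
begin

definition psum :: "('i \<Rightarrow> complex) \<Rightarrow> 'i set \<Rightarrow> 'a \<Rightarrow> complex" where
  "psum Z F x = (\<Sum>l\<in>F. Z l * e l x)"

text \<open>A relation rather than an operator, since \<open>f\<close> is determined only up to null
  sets. Bochner integrals of non-integrable functions are 0 by convention; demanding square
  integrability of \<open>f\<close> rules out convergence by that default.\<close>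

definition represents :: "('a \<Rightarrow> complex) \<Rightarrow> ('i \<Rightarrow> complex) \<Rightarrow> bool" where
  "represents f Z \<longleftrightarrow> sq_integrable M f \<and>
     ((\<lambda>F. \<integral>x. (cmod (f x - psum Z F x))\<^sup>2 \<partial>M) \<longlongrightarrow> 0) (finite_subsets_at_top I)"

lemma psum_sq: "F \<subseteq> I \<Longrightarrow> sq_integrable M (psum Z F)"
  unfolding psum_def by (intro sq_integrable_sum sq_integrable_cmult e_sq) auto

lemma psum_inner:
  assumes "F \<subseteq> I" "sq_integrable M g"
  shows "(\<integral>x. psum Z F x * cnj (g x) \<partial>M) = (\<Sum>l\<in>F. Z l * (\<integral>x. e l x * cnj (g x) \<partial>M))"
proof -
  have "(\<integral>x. psum Z F x * cnj (g x) \<partial>M) = (\<integral>x. (\<Sum>l\<in>F. Z l * (e l x * cnj (g x))) \<partial>M)"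
    by (simp add: psum_def sum_distrib_right mult.assoc)
  also have "\<dots> = (\<Sum>l\<in>F. \<integral>x. Z l * (e l x * cnj (g x)) \<partial>M)"
    using assms by (intro Bochner_Integration.integral_sum integrable_mult_right sq_integrable_inner e_sq) auto
  finally show ?thesis by simp
qed

lemma psum_coeff:
  assumes "F \<subseteq> I" "finite F" "l \<in> I"
  shows "(\<integral>x. psum Z F x * cnj (e l x) \<partial>M) = (if l \<in> F then Z l else 0)"
proof -
  have "(\<integral>x. psum Z F x * cnj (e l x) \<partial>M) = (\<Sum>l'\<in>F. Z l' * of_bool (l' = l))"
    using assms by (subst psum_inner) (auto intro!: sum.cong e_sq simp: orth subset_iff)
  also have "\<dots> = (\<Sum>l'\<in>F. if l' = l then Z l' else 0)"
    by (intro sum.cong) auto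
  also have "\<dots> = (if l \<in> F then Z l else 0)"
    using \<open>finite F\<close> by simp
  finally show ?thesis .
qed

lemma inner_cnj: "(\<integral>x. e l x * cnj (g x) \<partial>M) = cnj (\<integral>x. g x * cnj (e l x) \<partial>M)"
  by (subst Bochner_Integration.integral_cnj[symmetric]) (simp add: mult.commute)

lemma psum_norm:
  assumes "F \<subseteq> I" "finite F"
  shows "(\<integral>x. (cmod (psum Z F x))\<^sup>2 \<partial>M) = (\<Sum>l\<in>F. (cmod (Z l))\<^sup>2)"
proof -
  have "complex_of_real (\<integral>x. (cmod (psum Z F x))\<^sup>2 \<partial>M) = (\<integral>x. psum Z F x * cnj (psum Z F x) \<partial>M)"
    by (simp only: integral_complex_of_real[symmetric] cmod_power2_complex)
  also have "\<dots> = (\<Sum>l\<in>F. Z l * (\<integral>x. e l x * cnj (psum Z F x) \<partial>M))"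
    using assms by (intro psum_inner psum_sq)
  also have "\<dots> = (\<Sum>l\<in>F. Z l * cnj (\<integral>x. psum Z F x * cnj (e l x) \<partial>M))"
    by (simp only: inner_cnj)
  also have "\<dots> = (\<Sum>l\<in>F. Z l * cnj (Z l))"
    using assms by (intro sum.cong) (auto simp: psum_coeff subset_iff)
  also have "\<dots> = complex_of_real (\<Sum>l\<in>F. (cmod (Z l))\<^sup>2)"
    by (simp add: cmod_power2_complex del: of_real_power)
  finally show ?thesis by (metis of_real_eq_iff)
qed

text \<open>Terms over the intersection cancel, so orthonormality leaves the square sum over the
  symmetric difference of \<open>A\<close> and \<open>B\<close>, which avoids
  \<open>F\<close>.\<close>

lemma psum_diff_norm_le:
  assumes "A \<subseteq> I" "B \<subseteq> I" "finite A" "finite B" "F \<subseteq> A" "F \<subseteq> B"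
    and small: "\<And>H. finite H \<Longrightarrow> H \<subseteq> I \<Longrightarrow> H \<inter> F = {} \<Longrightarrow> (\<Sum>l\<in>H. (cmod (Z l))\<^sup>2) \<le> \<epsilon>"
  shows "(\<integral>x. (cmod (psum Z A x - psum Z B x))\<^sup>2 \<partial>M) \<le> \<epsilon>"
proof -
  define c where "c l = Z l * (of_bool (l \<in> A) - of_bool (l \<in> B))" for l
  have ext: "psum Z C x = (\<Sum>l\<in>A \<union> B. Z l * of_bool (l \<in> C) * e l x)" if "C = A \<or> C = B" for C x
    unfolding psum_def using assms that by (intro sum.mono_neutral_cong_left) auto
  have "psum Z A x - psum Z B x = psum c (A \<union> B) x" for x
    unfolding ext[of A, simplified] ext[of B, simplified]
    by (simp add: psum_def c_def algebra_simps flip: sum_subtractf)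
  then have "(\<integral>x. (cmod (psum Z A x - psum Z B x))\<^sup>2 \<partial>M) = (\<Sum>l\<in>A \<union> B. (cmod (c l))\<^sup>2)"
    using assms by (simp add: psum_norm)
  also have "\<dots> = (\<Sum>l\<in>(A - B) \<union> (B - A). (cmod (Z l))\<^sup>2)"
    using assms by (intro sum.mono_neutral_cong_right) (auto simp: c_def)
  also have "\<dots> \<le> \<epsilon>" using assms by (intro small) auto
  finally show ?thesis .
qed

lemma psum_Cauchy:
  assumes "(\<lambda>l. (cmod (Z l))\<^sup>2) summable_on I" "\<epsilon> > 0"
  obtains F where "finite F" "F \<subseteq> I"
    "\<And>H. finite H \<Longrightarrow> H \<subseteq> I \<Longrightarrow> H \<inter> F = {} \<Longrightarrow> (\<Sum>l\<in>H. (cmod (Z l))\<^sup>2) \<le> \<epsilon>"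
proof -
  define s where "s = infsum (\<lambda>l. (cmod (Z l))\<^sup>2) I"
  have hs: "((\<lambda>l. (cmod (Z l))\<^sup>2) has_sum s) I"
    using assms by (simp add: s_def)
  then have "\<forall>\<^sub>F F in finite_subsets_at_top I. s - \<epsilon> < (\<Sum>l\<in>F. (cmod (Z l))\<^sup>2)"
    unfolding has_sum_def by (rule order_tendstoD) (use assms in auto)
  then obtain F where F: "finite F" "F \<subseteq> I" "s - \<epsilon> < (\<Sum>l\<in>F. (cmod (Z l))\<^sup>2)"
    unfolding eventually_finite_subsets_at_top by blast
  have "(\<Sum>l\<in>H. (cmod (Z l))\<^sup>2) \<le> \<epsilon>" if "finite H" "H \<subseteq> I" "H \<inter> F = {}" for H
  proof -
    have "(\<Sum>l\<in>H \<union> F. (cmod (Z l))\<^sup>2) \<le> s"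
      unfolding s_def using that F assms by (intro finite_sum_le_infsum) auto
    then show ?thesis using that F by (simp add: sum.union_disjoint)
  qed
  with F show thesis by (intro that) auto
qed

text \<open>Along a sequence of finite index sets whose tails decay geometrically the partial sums
  converge almost everywhere; Fatou's lemma then gives convergence in mean.\<close>

lemma riesz_fischer:
  assumes sm: "(\<lambda>l. (cmod (Z l))\<^sup>2) summable_on I"
  shows "\<exists>f. represents f Z"
proof -
  \<comment> \<open>The rate 1/8 leaves room for the weight 2^n: the weighted square norms are
    bounded by 4^-n, and |d| <= 2^n |d|^2 + 2^-n turns their finite sum into absolute convergence
    almost everywhere.\<close>
  define \<epsilon> where "\<epsilon> n = (1/8::real) ^ n" for n
  have "\<exists>F. finite F \<and> F \<subseteq> I \<and> (\<forall>H. finite H \<longrightarrow> H \<subseteq> I \<longrightarrow> H \<inter> F = {} \<longrightarrow> (\<Sum>l\<in>H. (cmod (Z l))\<^sup>2) \<le> \<epsilon> n)" for n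
    by (rule psum_Cauchy[OF sm, of "\<epsilon> n"]) (auto simp: \<epsilon>_def)
  then obtain F where Ff: "finite (F n)" "F n \<subseteq> I"
    and FH: "\<And>H. finite H \<Longrightarrow> H \<subseteq> I \<Longrightarrow> H \<inter> F n = {} \<Longrightarrow> (\<Sum>l\<in>H. (cmod (Z l))\<^sup>2) \<le> \<epsilon> n" for n
    by metis
  \<comment> \<open>Taking unions makes every later index set contain \<open>F m\<close>, as the
    Cauchy estimate requires.\<close>
  define G where "G n = (\<Union>i\<le>n. F i)" for n
  have G: "finite (G n)" "G n \<subseteq> I" "m \<le> n \<Longrightarrow> F m \<subseteq> G n" for m n
    using Ff by (auto simp: G_def)
  define g where "g n = psum Z (G n)" for n
  have gsq: "sq_integrable M (g n)" for n unfolding g_def by (intro psum_sq G)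
  have [measurable]: "g n \<in> borel_measurable M" for n using gsq by (auto simp: sq_integrable_def)
  define d where "d n x = g (Suc n) x - g n x" for n x
  have dsq: "sq_integrable M (d n)" for n unfolding d_def by (intro sq_integrable_diff gsq)
  have [measurable]: "d n \<in> borel_measurable M" for n using dsq by (auto simp: sq_integrable_def)
  have dn: "(\<integral>x. (cmod (d n x))\<^sup>2 \<partial>M) \<le> \<epsilon> n" for n
    unfolding d_def g_def by (rule psum_diff_norm_le[where F="F n"]) (use G FH in auto)
  have "(\<integral>\<^sup>+x. (\<Sum>n. ennreal (2 ^ n * (cmod (d n x))\<^sup>2)) \<partial>M) = (\<Sum>n. \<integral>\<^sup>+x. ennreal (2 ^ n * (cmod (d n x))\<^sup>2) \<partial>M)"
    by (intro nn_integral_suminf) auto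
  also have "\<dots> \<le> (\<Sum>n. ennreal ((1/4) ^ n))"
  proof (rule suminf_le)
    fix n
    have "(\<integral>\<^sup>+x. ennreal (2 ^ n * (cmod (d n x))\<^sup>2) \<partial>M) = ennreal (\<integral>x. 2 ^ n * (cmod (d n x))\<^sup>2 \<partial>M)"
      using dsq by (intro nn_integral_eq_integral) (auto simp: sq_integrable_def)
    also have "\<dots> = ennreal (2 ^ n * (\<integral>x. (cmod (d n x))\<^sup>2 \<partial>M))" by simp
    also have "\<dots> \<le> ennreal (2 ^ n * \<epsilon> n)" by (intro ennreal_leI mult_left_mono dn) auto
    also have "2 ^ n * \<epsilon> n = (1/4) ^ n" by (simp add: \<epsilon>_def flip: power_mult_distrib)
    finally show "(\<integral>\<^sup>+x. ennreal (2 ^ n * (cmod (d n x))\<^sup>2) \<partial>M) \<le> ennreal ((1/4) ^ n)" .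
  qed auto
  also have "\<dots> = ennreal (\<Sum>n. (1/4) ^ n)"
    by (intro suminf_ennreal2) (auto intro: summable_geometric)
  also have "\<dots> < \<infinity>" by simp
  finally have "(\<integral>\<^sup>+x. (\<Sum>n. ennreal (2 ^ n * (cmod (d n x))\<^sup>2)) \<partial>M) \<noteq> \<infinity>" by simp
  then have "AE x in M. (\<Sum>n. ennreal (2 ^ n * (cmod (d n x))\<^sup>2)) \<noteq> \<infinity>"
    by (intro nn_integral_PInf_AE) auto
  then have conv: "AE x in M. convergent (\<lambda>n. g n x)"
  proof eventually_elim
    case (elim x)
    have "summable (\<lambda>n. 2 ^ n * (cmod (d n x))\<^sup>2)"
      by (rule summable_suminf_not_top) (use elim in auto)
    then have s: "summable (\<lambda>n. 2 ^ n * (cmod (d n x))\<^sup>2 + (1/2) ^ n)"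
      by (intro summable_add summable_geometric) auto
    have "norm (d n x) \<le> 2 ^ n * (cmod (d n x))\<^sup>2 + (1/2) ^ n" for n
    proof -
      have "2 * (2 ^ n * cmod (d n x)) \<le> (2 ^ n * cmod (d n x))\<^sup>2 + 1"
        using sum_squares_bound[of "2 ^ n * cmod (d n x)" 1] by simp
      then have "2 ^ n * cmod (d n x) \<le> (2 ^ n * cmod (d n x))\<^sup>2 + 1"
        using zero_le_power2[of "2 ^ n * cmod (d n x)"] by linarith
      also have "\<dots> = 2 ^ n * (2 ^ n * (cmod (d n x))\<^sup>2 + (1/2) ^ n)"
        by (simp add: algebra_simps power2_eq_square flip: power_mult_distrib)
      finally show ?thesis by simp
    qed
    then have "summable (\<lambda>n. d n x)"
      by (intro summable_norm_cancel[OF summable_comparison_test'[OF s]]) auto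
    then have "convergent (\<lambda>n. \<Sum>i<n. d i x)" by (simp add: summable_iff_convergent)
    then have "convergent (\<lambda>n. g n x - g 0 x)"
      by (simp add: d_def sum_lessThan_telescope[of "\<lambda>i. g i x"])
    then have "convergent (\<lambda>n. (g n x - g 0 x) + g 0 x)" by (intro convergent_add convergent_const)
    then show ?case by simp
  qed
  define f where "f x = lim (\<lambda>n. g n x)" for x
  have [measurable]: "f \<in> borel_measurable M"
    unfolding f_def by (rule borel_measurable_lim_metric) auto
  \<comment> \<open>The bound holds for every finite \<open>H\<close> containing \<open>F m\<close>,
    not only along the sequence \<open>G\<close>; this upgrades sequential convergence to
    convergence of the net.\<close>
  have fatou: "(\<integral>\<^sup>+x. ennreal ((cmod (f x - psum Z H x))\<^sup>2) \<partial>M) \<le> ennreal (\<epsilon> m)"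
    if H: "finite H" "H \<subseteq> I" "F m \<subseteq> H" for H m
  proof -
    have [measurable]: "psum Z H \<in> borel_measurable M"
      using psum_sq[OF H(2)] by (auto simp: sq_integrable_def)
    have "(\<integral>\<^sup>+x. ennreal ((cmod (f x - psum Z H x))\<^sup>2) \<partial>M)
      = (\<integral>\<^sup>+x. liminf (\<lambda>n. ennreal ((cmod (g n x - psum Z H x))\<^sup>2)) \<partial>M)"
      using conv
    proof (intro nn_integral_cong_AE, eventually_elim)
      case (elim x)
      then have "(\<lambda>n. g n x) \<longlonglongrightarrow> f x" unfolding f_def by (simp add: convergent_LIMSEQ_iff)
      then have "(\<lambda>n. ennreal ((cmod (g n x - psum Z H x))\<^sup>2)) \<longlonglongrightarrow> ennreal ((cmod (f x - psum Z H x))\<^sup>2)"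
        by (intro tendsto_intros)
      then show ?case by (intro lim_imp_Liminf[symmetric]) simp
    qed
    also have "\<dots> \<le> liminf (\<lambda>n. \<integral>\<^sup>+x. ennreal ((cmod (g n x - psum Z H x))\<^sup>2) \<partial>M)"
      by (intro nn_integral_liminf) auto
    also have "\<dots> \<le> liminf (\<lambda>n. ennreal (\<epsilon> m))"
    proof (rule Liminf_mono, rule eventually_sequentiallyI[of m])
      fix n assume "n \<ge> m"
      have "(\<integral>\<^sup>+x. ennreal ((cmod (g n x - psum Z H x))\<^sup>2) \<partial>M) = ennreal (\<integral>x. (cmod (g n x - psum Z H x))\<^sup>2 \<partial>M)"
        using sq_integrable_diff[OF gsq psum_sq[OF H(2)]]
        by (intro nn_integral_eq_integral) (auto simp: sq_integrable_def)
      also have "\<dots> \<le> ennreal (\<epsilon> m)"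
        unfolding g_def by (intro ennreal_leI psum_diff_norm_le[where F="F m"]) (use G H FH \<open>n \<ge> m\<close> in auto)
      finally show "(\<integral>\<^sup>+x. ennreal ((cmod (g n x - psum Z H x))\<^sup>2) \<partial>M) \<le> ennreal (\<epsilon> m)" .
    qed
    also have "\<dots> = ennreal (\<epsilon> m)" by (intro lim_imp_Liminf) auto
    finally show ?thesis .
  qed
  have dsq': "sq_integrable M (\<lambda>x. f x - psum Z H x)" if H: "finite H" "H \<subseteq> I" "F m \<subseteq> H" for H m
  proof -
    have [measurable]: "psum Z H \<in> borel_measurable M"
      using psum_sq[OF H(2)] by (auto simp: sq_integrable_def)
    have "(\<integral>\<^sup>+x. ennreal ((cmod (f x - psum Z H x))\<^sup>2) \<partial>M) < \<infinity>"
      using fatou[OF H] by (simp add: order_le_less_trans[OF _ ennreal_less_top])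
    then show ?thesis by (auto simp: sq_integrable_def integrable_iff_bounded)
  qed
  have fsq: "sq_integrable M f"
    using sq_integrable_add[OF dsq'[of "F 0" 0] psum_sq[of "F 0" Z]] Ff by auto
  have "((\<lambda>H. \<integral>x. (cmod (f x - psum Z H x))\<^sup>2 \<partial>M) \<longlongrightarrow> 0) (finite_subsets_at_top I)"
  proof (rule order_tendstoI)
    fix a :: real assume "a < 0"
    then show "\<forall>\<^sub>F H in finite_subsets_at_top I. a < (\<integral>x. (cmod (f x - psum Z H x))\<^sup>2 \<partial>M)"
      by (auto intro!: always_eventually less_le_trans[OF _ Bochner_Integration.integral_nonneg])
  next
    fix a :: real assume a: "0 < a"
    obtain m where m: "\<epsilon> m < a" using real_arch_pow_inv[OF a, of "1/8"] by (auto simp: \<epsilon>_def)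
    have "(\<integral>x. (cmod (f x - psum Z H x))\<^sup>2 \<partial>M) < a" if H: "finite H" "F m \<subseteq> H" "H \<subseteq> I" for H
    proof -
      have "ennreal (\<integral>x. (cmod (f x - psum Z H x))\<^sup>2 \<partial>M) = (\<integral>\<^sup>+x. ennreal ((cmod (f x - psum Z H x))\<^sup>2) \<partial>M)"
        using dsq'[OF H(1,3,2)] by (intro nn_integral_eq_integral[symmetric]) (auto simp: sq_integrable_def)
      also have "\<dots> \<le> ennreal (\<epsilon> m)" by (rule fatou[OF H(1,3,2)])
      finally have "(\<integral>x. (cmod (f x - psum Z H x))\<^sup>2 \<partial>M) \<le> \<epsilon> m"
        by (subst (asm) ennreal_le_iff) (auto simp: \<epsilon>_def)
      then show ?thesis using m by simp
    qed
    then show "\<forall>\<^sub>F H in finite_subsets_at_top I. (\<integral>x. (cmod (f x - psum Z H x))\<^sup>2 \<partial>M) < a"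
      unfolding eventually_finite_subsets_at_top using Ff[of m] by (intro exI[of _ "F m"]) simp
  qed
  with fsq show ?thesis unfolding represents_def by blast
qed

text \<open>Cauchy-Schwarz bounds the error by the norm of \<open>f - psum Z F\<close>. With
  \<open>g = e l\<close> this identifies the coefficients of \<open>f\<close>; with
  \<open>g = f\<close> it becomes Parseval's identity.\<close>

lemma represents_inner:
  assumes f: "represents f Z" and g: "sq_integrable M g"
  shows "((\<lambda>l. Z l * (\<integral>x. e l x * cnj (g x) \<partial>M)) has_sum (\<integral>x. f x * cnj (g x) \<partial>M)) I"
proof -
  have fs: "sq_integrable M f" using f by (simp add: represents_def)
  define B where "B = (\<integral>x. (cmod (g x))\<^sup>2 \<partial>M)"
  have "((\<lambda>F. (\<integral>x. (cmod (f x - psum Z F x))\<^sup>2 \<partial>M) * B) \<longlongrightarrow> 0 * B) (finite_subsets_at_top I)"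
    using f by (intro tendsto_intros) (auto simp: represents_def)
  then have lim: "((\<lambda>F. sqrt ((\<integral>x. (cmod (f x - psum Z F x))\<^sup>2 \<partial>M) * B)) \<longlongrightarrow> 0) (finite_subsets_at_top I)"
    using tendsto_real_sqrt by fastforce
  have "((\<lambda>F. (\<integral>x. f x * cnj (g x) \<partial>M) - (\<Sum>l\<in>F. Z l * (\<integral>x. e l x * cnj (g x) \<partial>M))) \<longlongrightarrow> 0) (finite_subsets_at_top I)"
  proof (rule Lim_null_comparison[OF _ lim], rule eventually_finite_subsets_at_top_weakI)
    fix F assume F: "finite F" "F \<subseteq> I"
    have "(\<integral>x. f x * cnj (g x) \<partial>M) - (\<Sum>l\<in>F. Z l * (\<integral>x. e l x * cnj (g x) \<partial>M))
      = (\<integral>x. (f x - psum Z F x) * cnj (g x) \<partial>M)"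
      using sq_integrable_inner[OF fs g] sq_integrable_inner[OF psum_sq[OF F(2)] g]
      by (simp add: psum_inner[OF F(2) g, symmetric] left_diff_distrib)
    moreover have "(cmod (\<integral>x. (f x - psum Z F x) * cnj (g x) \<partial>M))\<^sup>2 \<le> (\<integral>x. (cmod (f x - psum Z F x))\<^sup>2 \<partial>M) * B"
      unfolding B_def by (intro cauchy_schwarz_integral sq_integrable_diff fs g psum_sq F)
    ultimately show "cmod ((\<integral>x. f x * cnj (g x) \<partial>M) - (\<Sum>l\<in>F. Z l * (\<integral>x. e l x * cnj (g x) \<partial>M)))
      \<le> sqrt ((\<integral>x. (cmod (f x - psum Z F x))\<^sup>2 \<partial>M) * B)"
      by (simp add: real_le_rsqrt)
  qed
  then have "((\<lambda>F. (\<integral>x. f x * cnj (g x) \<partial>M) - ((\<integral>x. f x * cnj (g x) \<partial>M) - (\<Sum>l\<in>F. Z l * (\<integral>x. e l x * cnj (g x) \<partial>M))))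
     \<longlongrightarrow> (\<integral>x. f x * cnj (g x) \<partial>M) - 0) (finite_subsets_at_top I)"
    by (intro tendsto_diff tendsto_const)
  then show ?thesis by (simp add: has_sum_def)
qed

lemma represents_coeff:
  assumes f: "represents f Z" and l: "l \<in> I"
  shows "(\<integral>x. f x * cnj (e l x) \<partial>M) = Z l"
proof -
  have "((\<lambda>l'. Z l' * (\<integral>x. e l' x * cnj (e l x) \<partial>M)) has_sum (\<integral>x. f x * cnj (e l x) \<partial>M)) I"
    by (rule represents_inner[OF f e_sq[OF l]])
  moreover have "((\<lambda>l'. Z l' * (\<integral>x. e l' x * cnj (e l x) \<partial>M)) has_sum Z l) I"
    by (rule has_sum_finite_neutralI[where B="{l}"]) (use l in \<open>auto simp: orth\<close>)
  ultimately show ?thesis by (rule has_sum_unique)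
qed

text \<open>Pairing \<open>g\<close> with its own partial expansion, whose square norm is S, gives
  S^2 <= S times the square norm of \<open>g\<close>.\<close>

lemma bessel:
  assumes g: "sq_integrable M g"
  shows "(\<lambda>l. (cmod (\<integral>x. g x * cnj (e l x) \<partial>M))\<^sup>2) summable_on I"
proof (rule nonneg_bdd_above_summable_on)
  let ?c = "\<lambda>l. \<integral>x. g x * cnj (e l x) \<partial>M"
  show "bdd_above (sum (\<lambda>l. (cmod (?c l))\<^sup>2) ` {F. F \<subseteq> I \<and> finite F})"
  proof (rule bdd_aboveI2)
    fix F assume "F \<in> {F. F \<subseteq> I \<and> finite F}"
    then have F: "F \<subseteq> I" "finite F" by auto
    define S where "S = (\<Sum>l\<in>F. (cmod (?c l))\<^sup>2)"
    have "(\<integral>x. psum ?c F x * cnj (g x) \<partial>M) = (\<Sum>l\<in>F. ?c l * cnj (?c l))"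
      using psum_inner[OF F(1) g] by (simp add: inner_cnj)
    also have "\<dots> = complex_of_real S"
      by (simp add: S_def cmod_power2_complex del: of_real_power)
    finally have "cmod (\<integral>x. psum ?c F x * cnj (g x) \<partial>M) = \<bar>S\<bar>"
      by (simp only: norm_of_real)
    then have "S\<^sup>2 \<le> S * (\<integral>x. (cmod (g x))\<^sup>2 \<partial>M)"
      using cauchy_schwarz_integral[OF psum_sq[OF F(1), of ?c] g] psum_norm[OF F, of ?c, folded S_def]
      by (simp only: power2_abs)
    moreover have "S \<ge> 0" by (auto simp: S_def intro: sum_nonneg)
    ultimately show "S \<le> (\<integral>x. (cmod (g x))\<^sup>2 \<partial>M)"
      by (cases "S = 0") (auto simp: power2_eq_square)
  qed
qed auto

text \<open>Riesz-Fischer yields some function with the coefficients of \<open>g\<close>; by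
  \<open>total\<close> it agrees with \<open>g\<close> almost everywhere.\<close>

lemma represents_expansion:
  assumes g: "sq_integrable M g" and Z: "\<And>l. l \<in> I \<Longrightarrow> Z l = (\<integral>x. g x * cnj (e l x) \<partial>M)"
  shows "represents g Z"
proof -
  have "(\<lambda>l. (cmod (Z l))\<^sup>2) summable_on I"
    using bessel[OF g] Z by (auto cong: summable_on_cong)
  then obtain f where f: "represents f Z" using riesz_fischer by blast
  have fs: "sq_integrable M f" using f by (simp add: represents_def)
  have "AE x in M. f x - g x = 0"
  proof (rule total)
    fix l assume l: "l \<in> I"
    show "(\<integral>x. (f x - g x) * cnj (e l x) \<partial>M) = 0"
      using sq_integrable_inner[OF fs e_sq[OF l]] sq_integrable_inner[OF g e_sq[OF l]]
        represents_coeff[OF f l] Z[OF l] by (simp add: left_diff_distrib)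
  qed (intro sq_integrable_diff fs g)
  then have fg: "AE x in M. f x = g x" by simp
  have [measurable]: "f \<in> borel_measurable M" "g \<in> borel_measurable M"
    using fs g by (auto simp: sq_integrable_def)
  have "(\<integral>x. (cmod (f x - psum Z F x))\<^sup>2 \<partial>M) = (\<integral>x. (cmod (g x - psum Z F x))\<^sup>2 \<partial>M)" if "F \<subseteq> I" for F
  proof (rule integral_cong_AE)
    have [measurable]: "psum Z F \<in> borel_measurable M"
      using psum_sq[OF that] by (auto simp: sq_integrable_def)
    show "(\<lambda>x. (cmod (f x - psum Z F x))\<^sup>2) \<in> borel_measurable M"
      "(\<lambda>x. (cmod (g x - psum Z F x))\<^sup>2) \<in> borel_measurable M" by measurable
  qed (use fg in auto)
  then have "((\<lambda>F. \<integral>x. (cmod (g x - psum Z F x))\<^sup>2 \<partial>M) \<longlongrightarrow> 0) (finite_subsets_at_top I)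
    \<longleftrightarrow> ((\<lambda>F. \<integral>x. (cmod (f x - psum Z F x))\<^sup>2 \<partial>M) \<longlongrightarrow> 0) (finite_subsets_at_top I)"
    by (intro tendsto_cong eventually_finite_subsets_at_top_weakI) auto
  then show ?thesis using f g by (simp add: represents_def)
qed

lemma parseval:
  assumes g: "sq_integrable M g"
  shows "((\<lambda>l. (cmod (\<integral>x. g x * cnj (e l x) \<partial>M))\<^sup>2) has_sum (\<integral>x. (cmod (g x))\<^sup>2 \<partial>M)) I"
proof -
  have "((\<lambda>l. complex_of_real ((cmod (\<integral>x. g x * cnj (e l x) \<partial>M))\<^sup>2)) has_sum (\<integral>x. complex_of_real ((cmod (g x))\<^sup>2) \<partial>M)) I"
    using represents_inner[OF represents_expansion[OF g refl] g]
    by (simp only: cmod_power2_complex inner_cnj)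
  then show ?thesis by (simp only: integral_complex_of_real has_sum_of_real_iff)
qed

end

section \<open>Exponential bases on intervals and on Omega\<close>

abbreviation leb_on :: "real set \<Rightarrow> real measure" where
  "leb_on X \<equiv> restrict_space lborel X"

lemma finite_measure_leb_on:
  assumes "X \<in> sets borel" "bounded X"
  shows "finite_measure (leb_on X)"
proof -
  have "emeasure lborel X < \<infinity>" using emeasure_bounded_finite[OF assms(2)] .
  then show ?thesis
    using assms by (intro finite_measureI) (simp add: emeasure_restrict_space)
qed

lemma measurable_leb_on: "f \<in> borel_measurable borel \<Longrightarrow> f \<in> borel_measurable (leb_on X)"
  by (intro measurable_restrict_space1) simp

lemma borel_measurable_cis [measurable]: "cis \<in> borel_measurable borel"
  by (intro borel_measurable_continuous_onI continuous_intros)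

lemma AE_lborel_translate:
  fixes P :: "real \<Rightarrow> bool"
  assumes "AE x in lborel. P x"
  shows "AE x in lborel. P (x + s)"
proof -
  from assms obtain Z where Z: "Z \<in> null_sets lborel" "{x. \<not> P x} \<subseteq> Z"
    by (auto simp: eventually_ae_filter)
  then have [measurable]: "Z \<in> sets borel" by (auto simp: null_sets_def)
  have "AE x in lborel. x \<notin> Z" by (rule AE_not_in[OF Z(1)])
  then have "AE x in lborel. s + 1 * x \<notin> Z"
    by (intro AE_borel_affine) auto
  then show ?thesis
    by eventually_elim (use Z(2) in \<open>auto simp: add.commute\<close>)
qed

lemma AE_lborel_translate_iff:
  fixes P :: "real \<Rightarrow> bool"
  shows "(AE x in lborel. P (x + s)) \<longleftrightarrow> (AE x in lborel. P x)"
proof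
  assume "AE x in lborel. P (x + s)"
  from AE_lborel_translate[OF this, of "-s"] show "AE x in lborel. P x" by simp
qed (rule AE_lborel_translate)

text \<open>Applied to \<open>Omega N\<close> at two scales: two intervals of length 1/2 for
  completeness of the exponentials, and 4N intervals of length 1/(4N) for the matrix rows.\<close>

locale tiling =
  fixes X :: "real set" and J :: "'j set" and s :: "'j \<Rightarrow> real" and d :: real
  assumes finite_J: "finite J"
    and X_eq: "X = (\<Union>j\<in>J. {s j..<s j + d})"
    and disj: "i \<in> J \<Longrightarrow> j \<in> J \<Longrightarrow> i \<noteq> j \<Longrightarrow> {s i..<s i + d} \<inter> {s j..<s j + d} = {}"
begin

lemma X_borel [measurable]: "X \<in> sets borel"
proof -
  have "(\<Union>j\<in>J. {s j..<s j + d}) \<in> sets borel"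
    using finite_J by induction auto
  then show ?thesis by (simp add: X_eq)
qed

lemma in_X_shift: "j \<in> J \<Longrightarrow> x \<in> {0..<d} \<Longrightarrow> x + s j \<in> X"
  by (force simp: X_eq)

lemma AE_tiling: "(AE x in leb_on X. P x) \<longleftrightarrow> (\<forall>j\<in>J. AE x in leb_on {0..<d}. P (x + s j))"
proof -
  have "(AE x in leb_on X. P x) \<longleftrightarrow> (AE x in lborel. \<forall>j\<in>J. x \<in> {s j..<s j + d} \<longrightarrow> P x)"
    by (subst AE_restrict_space_iff, simp) (auto simp: X_eq intro!: AE_cong)
  also have "\<dots> \<longleftrightarrow> (\<forall>j\<in>J. AE x in lborel. x \<in> {s j..<s j + d} \<longrightarrow> P x)"
    by (rule AE_finite_all[OF finite_J])
  also have "\<dots> \<longleftrightarrow> (\<forall>j\<in>J. AE x in lborel. x + s j \<in> {s j..<s j + d} \<longrightarrow> P (x + s j))"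
    by (intro ball_cong refl AE_lborel_translate_iff[symmetric, where P="\<lambda>x. x \<in> {s j..<s j + d} \<longrightarrow> P x" for j])
  also have "\<dots> \<longleftrightarrow> (\<forall>j\<in>J. AE x in leb_on {0..<d}. P (x + s j))"
    by (intro ball_cong refl, subst AE_restrict_space_iff) (auto intro!: AE_cong)
  finally show ?thesis .
qed

lemma indicator_tiling: "indicat_real X x = (\<Sum>j\<in>J. indicator {s j..<s j + d} x)"
  unfolding X_eq using finite_J disj
  by (intro indicator_UN_disjoint) (auto simp: disjoint_family_on_def)

lemma indicator_shift:
  fixes f :: "real \<Rightarrow> 'b::real_vector"
  shows "(\<lambda>x. indicator {s j..<s j + d} (s j + 1 * x) *\<^sub>R f (s j + 1 * x)) = (\<lambda>x. indicator {0..<d} x *\<^sub>R f (x + s j))"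
  by (auto simp: fun_eq_iff indicator_def add.commute)

lemma integrable_tile:
  fixes f :: "real \<Rightarrow> 'b::{banach, second_countable_topology}"
  shows "integrable lborel (\<lambda>x. indicator {s j..<s j + d} x *\<^sub>R f x) \<longleftrightarrow>
    integrable (leb_on {0..<d}) (\<lambda>x. f (x + s j))"
proof -
  have "integrable lborel (\<lambda>x. indicator {s j..<s j + d} x *\<^sub>R f x) \<longleftrightarrow>
    integrable lborel (\<lambda>x. indicator {s j..<s j + d} (s j + 1 * x) *\<^sub>R f (s j + 1 * x))"
    by (rule lborel_integrable_real_affine_iff[symmetric]) simp
  then show ?thesis
    unfolding indicator_shift by (simp add: integrable_restrict_space)
qed

lemma integral_tile:
  fixes f :: "real \<Rightarrow> 'b::{banach, second_countable_topology}"
  shows "(\<integral>x. indicator {s j..<s j + d} x *\<^sub>R f x \<partial>lborel) = (\<integral>x. f (x + s j) \<partial>leb_on {0..<d})"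
  by (subst lborel_integral_real_affine[of 1 _ "s j"], simp, unfold indicator_shift)
    (simp add: integral_restrict_space)

lemma integrable_tiling:
  fixes f :: "real \<Rightarrow> 'b::{banach, second_countable_topology}"
  shows "integrable (leb_on X) f \<longleftrightarrow> (\<forall>j\<in>J. integrable (leb_on {0..<d}) (\<lambda>x. f (x + s j)))"
proof -
  have "integrable (leb_on X) f \<longleftrightarrow> integrable lborel (\<lambda>x. indicator X x *\<^sub>R f x)"
    by (simp add: integrable_restrict_space)
  also have "\<dots> \<longleftrightarrow> (\<forall>j\<in>J. integrable lborel (\<lambda>x. indicator {s j..<s j + d} x *\<^sub>R f x))"
  proof
    assume *: "integrable lborel (\<lambda>x. indicator X x *\<^sub>R f x)"
    show "\<forall>j\<in>J. integrable lborel (\<lambda>x. indicator {s j..<s j + d} x *\<^sub>R f x)"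
    proof
      fix j assume "j \<in> J"
      have "integrable lborel (\<lambda>x. indicator {s j..<s j + d} x *\<^sub>R (indicator X x *\<^sub>R f x))"
        by (intro integrable_mult_indicator *) auto
      also have "(\<lambda>x. indicator {s j..<s j + d} x *\<^sub>R (indicator X x *\<^sub>R f x)) = (\<lambda>x. indicator {s j..<s j + d} x *\<^sub>R f x)"
      proof
        fix x
        have "x \<in> X" if "x \<in> {s j..<s j + d}" using that \<open>j \<in> J\<close> unfolding X_eq by blast
        then show "indicator {s j..<s j + d} x *\<^sub>R (indicator X x *\<^sub>R f x) = indicator {s j..<s j + d} x *\<^sub>R f x"
          by (cases "x \<in> {s j..<s j + d}") simp_all
      qed
      finally show "integrable lborel (\<lambda>x. indicator {s j..<s j + d} x *\<^sub>R f x)" .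
    qed
  next
    assume "\<forall>j\<in>J. integrable lborel (\<lambda>x. indicator {s j..<s j + d} x *\<^sub>R f x)"
    then show "integrable lborel (\<lambda>x. indicator X x *\<^sub>R f x)"
      by (simp add: indicator_tiling scaleR_sum_left)
  qed
  finally show ?thesis by (simp add: integrable_tile)
qed

lemma integral_tiling:
  fixes f :: "real \<Rightarrow> 'b::{banach, second_countable_topology}"
  assumes "integrable (leb_on X) f"
  shows "(\<integral>x. f x \<partial>leb_on X) = (\<integral>x. (\<Sum>j\<in>J. f (x + s j)) \<partial>leb_on {0..<d})"
proof -
  have I: "integrable (leb_on {0..<d}) (\<lambda>x. f (x + s j))" if "j \<in> J" for j
    using assms that integrable_tiling by blast
  have "(\<integral>x. f x \<partial>leb_on X) = (\<integral>x. (\<Sum>j\<in>J. indicator {s j..<s j + d} x *\<^sub>R f x) \<partial>lborel)"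
    by (simp add: integral_restrict_space indicator_tiling scaleR_sum_left)
  also have "\<dots> = (\<Sum>j\<in>J. \<integral>x. indicator {s j..<s j + d} x *\<^sub>R f x \<partial>lborel)"
    by (rule Bochner_Integration.integral_sum) (use I integrable_tile in blast)
  also have "\<dots> = (\<Sum>j\<in>J. \<integral>x. f (x + s j) \<partial>leb_on {0..<d})"
    by (simp add: integral_tile)
  also have "\<dots> = (\<integral>x. (\<Sum>j\<in>J. f (x + s j)) \<partial>leb_on {0..<d})"
    by (rule Bochner_Integration.integral_sum[symmetric]) (use I in blast)
  finally show ?thesis .
qed

lemma borel_measurable_tiling:
  fixes f :: "real \<Rightarrow> 'b::{real_normed_vector, second_countable_topology}"
  assumes "f \<in> borel_measurable (leb_on X)" "j \<in> J"
  shows "(\<lambda>x. f (x + s j)) \<in> borel_measurable (leb_on {0..<d})"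
proof -
  have "(\<lambda>x. x + s j) \<in> measurable (leb_on {0..<d}) (leb_on X)"
    using in_X_shift[OF assms(2)]
    by (intro measurable_restrict_space2 measurable_restrict_space1) (auto simp: space_restrict_space)
  from measurable_compose[OF this assms(1)] show ?thesis .
qed

lemma sq_integrable_tiling:
  assumes "sq_integrable (leb_on X) f" "j \<in> J"
  shows "sq_integrable (leb_on {0..<d}) (\<lambda>x. f (x + s j))"
  using assms integrable_tiling[of "\<lambda>x. (cmod (f x))\<^sup>2"] borel_measurable_tiling[of f j]
  by (auto simp: sq_integrable_def)

end

section \<open>Trigonometric systems on an interval\<close>

lemma integral_cis_period:
  assumes L: "L > 0"
  shows "(\<integral>x. cis (2 * pi * of_int n * x / L) \<partial>leb_on {0..<L}) = (if n = 0 then of_real L else 0)"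
proof -
  \<comment> \<open>Adding the endpoint \<open>L\<close>, a null set, gives the closed interval
    needed for the fundamental theorem of calculus.\<close>
  have "(\<integral>x. cis (2 * pi * of_int n * x / L) \<partial>leb_on {0..<L}) = (\<integral>x. indicator {0..L} x *\<^sub>R cis (2 * pi * of_int n * x / L) \<partial>lborel)"
  proof (subst integral_restrict_space, simp, rule integral_cong_AE)
    show "AE x in lborel. indicator {0..<L} x *\<^sub>R cis (2 * pi * of_int n * x / L) = indicator {0..L} x *\<^sub>R cis (2 * pi * of_int n * x / L)"
      using AE_lborel_singleton[of L] by eventually_elim (auto simp: indicator_def)
    show "(\<lambda>x. indicat_real {0..<L} x *\<^sub>R cis (2 * pi * of_int n * x / L)) \<in> borel_measurable lborel"
      "(\<lambda>x. indicat_real {0..L} x *\<^sub>R cis (2 * pi * of_int n * x / L)) \<in> borel_measurable lborel"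
      by measurable
  qed
  also have "\<dots> = (if n = 0 then of_real L else 0)"
  proof (cases "n = 0")
    case True
    have "(\<integral>x. indicat_real {0..L} x *\<^sub>R (1::complex) \<partial>lborel) = (\<integral>x. indicat_real {0..L} x \<partial>lborel) *\<^sub>R 1"
      by (rule integral_scaleR_left) (use L in \<open>auto simp: integrable_indicator_iff\<close>)
    also have "\<dots> = of_real L" using L by (simp add: of_real_def)
    finally show ?thesis using True by simp
  next
    case False
    define c where "c = 2 * pi * of_int n / L"
    have c: "c \<noteq> 0" using False L by (simp add: c_def)
    have cis: "cis (2 * pi * of_int n * x / L) = cis (c * x)" for x by (simp add: c_def)
    have "((\<lambda>x. cis (c * x) / (\<i> * c)) has_vector_derivative cis (c * x)) (at x within {0..L})" for x
    proof -
      have "((\<lambda>x. exp (\<i> * c * x) / (\<i> * c)) has_vector_derivative (exp (\<i> * c * x) * (\<i> * c)) / (\<i> * c)) (at x within {0..L})"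
        by (rule has_vector_derivative_real_field) (use c in \<open>auto intro!: derivative_eq_intros\<close>)
      then show ?thesis using c by (simp add: cis_conv_exp mult_ac)
    qed
    then have "(\<integral>x. indicator {0..L} x *\<^sub>R cis (c * x) \<partial>lborel) = cis (c * L) / (\<i> * c) - cis (c * 0) / (\<i> * c)"
      using L by (intro integral_FTC_Icc) (auto intro!: continuous_intros)
    also have "cis (c * L) = 1"
      using L cis_multiple_2pi[of "of_int n"] by (simp add: c_def mult.commute mult.left_commute)
    finally show ?thesis using False by (simp add: cis)
  qed
  finally show ?thesis .
qed

lemma sq_integrable_cis:
  assumes "X \<in> sets borel" "bounded X"
  shows "sq_integrable (leb_on X) (\<lambda>x. c * cis (a * x))"
proof -
  interpret finite_measure "leb_on X" using assms by (rule finite_measure_leb_on)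
  show ?thesis
    by (auto simp: sq_integrable_def norm_mult intro!: measurable_leb_on)
qed

lemma orthonormal_basis_interval:
  assumes L: "L > 0"
  shows "orthonormal_basis (leb_on {0..<L}) (\<lambda>n::int. \<lambda>x. of_real (1 / sqrt L) * cis (2 * pi * of_int n * x / L)) UNIV"
proof
  fix l :: int
  show "sq_integrable (leb_on {0..<L}) (\<lambda>x. of_real (1 / sqrt L) * cis (2 * pi * of_int l * x / L))"
    using sq_integrable_cis[of "{0..<L}" "of_real (1 / sqrt L)" "2 * pi * of_int l / L"] by simp
next
  fix l l' :: int
  have "of_real (1 / sqrt L) * cis (2 * pi * of_int l * x / L) * cnj (of_real (1 / sqrt L) * cis (2 * pi * of_int l' * x / L))
    = of_real (1 / L) * cis (2 * pi * of_int (l - l') * x / L)" for x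
  proof -
    have "complex_of_real (1 / sqrt L) * of_real (1 / sqrt L) = of_real (1 / L)"
      using L by (simp flip: of_real_mult)
    moreover have "cis (2 * pi * of_int l * x / L) * cnj (cis (2 * pi * of_int l' * x / L)) = cis (2 * pi * of_int (l - l') * x / L)"
      by (simp add: cis_cnj cis_mult algebra_simps diff_divide_distrib)
    ultimately show ?thesis by (simp add: mult_ac)
  qed
  then show "(\<integral>x. of_real (1 / sqrt L) * cis (2 * pi * of_int l * x / L) * cnj (of_real (1 / sqrt L) * cis (2 * pi * of_int l' * x / L)) \<partial>leb_on {0..<L}) = of_bool (l = l')"
    using L integral_cis_period[OF L, of "l - l'"] by (simp only:) simp
next
  fix f :: "real \<Rightarrow> complex"
  assume f: "sq_integrable (leb_on {0..<L}) f"
    and f0: "\<And>l::int. l \<in> UNIV \<Longrightarrow> (\<integral>x. f x * cnj (of_real (1 / sqrt L) * cis (2 * pi * of_int l * x / L)) \<partial>leb_on {0..<L}) = 0"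
  show "AE x in leb_on {0..<L}. f x = 0"
  proof (rule fourier_uniqueness_interval[OF L])
    interpret finite_measure "leb_on {0..<L}" by (intro finite_measure_leb_on) auto
    show "integrable (leb_on {0..<L}) f" using f by (rule sq_integrable_integrable)
    fix n :: int
    have "f x * cnj (of_real (1 / sqrt L) * cis (2 * pi * of_int (-n) * x / L)) = of_real (1 / sqrt L) * (f x * cis (2 * pi * of_int n * x / L))" for x
      by (simp add: cis_cnj)
    with f0[of "-n"] L show "(\<integral>x. f x * cis (2 * pi * of_int n * x / L) \<partial>leb_on {0..<L}) = 0"
      by (simp only:) simp
  qed
qed

text \<open>The exponentials here have modulus 1 instead of 1 / sqrt L, which accounts for the
  factor \<open>L\<close>.\<close>

lemma parseval_interval:
  assumes L: "L > 0" and f: "sq_integrable (leb_on {0..<L}) f"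
  shows "((\<lambda>n::int. (cmod (\<integral>x. f x * cis (- (2 * pi * of_int n * x / L)) \<partial>leb_on {0..<L}))\<^sup>2) has_sum
    (L * (\<integral>x. (cmod (f x))\<^sup>2 \<partial>leb_on {0..<L}))) UNIV"
proof -
  interpret orthonormal_basis "leb_on {0..<L}" "\<lambda>n::int. \<lambda>x. of_real (1 / sqrt L) * cis (2 * pi * of_int n * x / L)" UNIV
    using L by (rule orthonormal_basis_interval)
  have eq: "f x * cnj (of_real (1 / sqrt L) * cis (2 * pi * of_int n * x / L)) = of_real (1 / sqrt L) * (f x * cis (- (2 * pi * of_int n * x / L)))" for x and n::int
    by (simp add: cis_cnj)
  have "L * (cmod (\<integral>x. f x * cnj (of_real (1 / sqrt L) * cis (2 * pi * of_int n * x / L)) \<partial>leb_on {0..<L}))\<^sup>2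
    = (cmod (\<integral>x. f x * cis (- (2 * pi * of_int n * x / L)) \<partial>leb_on {0..<L}))\<^sup>2" for n::int
    unfolding eq using L by (simp add: norm_mult power_mult_distrib norm_divide power_divide)
  then show ?thesis using has_sum_cmult_right[OF parseval[OF f], of L] by simp
qed

text \<open>The set \<open>Omega N\<close> is tiled by the translates of \<open>[0, 1/(4N))\<close> by these \<open>4N\<close> shifts, numbered in the
  order of the entries of the columns \<open>colA\<close> and \<open>colB\<close> (whose index starts at \<open>0\<close>).\<close>

definition omega_shift :: "nat \<Rightarrow> nat \<Rightarrow> real" where
  "omega_shift N i = (if i < 2 * N then real i / (4 * real N) else real N / 2 + real (i - 2 * N) / (4 * real N))"

lemma tiling_Omega_halves:
  assumes "N \<ge> 1"
  shows "tiling (Omega N) {..<2::nat} (\<lambda>j. real j * (real N / 2)) (1/2)"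
proof
  have *: "{..<2::nat} = {0, 1}" by auto
  show "Omega N = (\<Union>j\<in>{..<2::nat}. {real j * (real N / 2)..<real j * (real N / 2) + 1/2})"
    unfolding * by (simp add: Omega_def add_divide_distrib)
  show "{real i * (real N / 2)..<real i * (real N / 2) + 1/2} \<inter> {real j * (real N / 2)..<real j * (real N / 2) + 1/2} = {}"
    if "i \<in> {..<2}" "j \<in> {..<2}" "i \<noteq> j" for i j
    using that assms unfolding * by auto
qed simp

lemma interval_grid:
  fixes x h :: real
  assumes "h > 0" "0 \<le> x" "x < real n * h"
  obtains t where "t < n" "real t * h \<le> x" "x < real t * h + h"
proof -
  define t where "t = nat \<lfloor>x / h\<rfloor>"
  have "0 \<le> x / h" using assms by simp
  then have t: "real t \<le> x / h" "x / h < real t + 1" unfolding t_def by linarith+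
  have "real t < real n" using t(1) assms by (metis le_less_trans pos_divide_less_eq)
  then show thesis using t assms by (intro that[of t]) (auto simp: field_simps)
qed

lemma tiling_Omega_fine:
  assumes "N \<ge> 1"
  shows "tiling (Omega N) {..<4*N} (omega_shift N) (1 / (4 * real N))"
proof
  define h where "h = 1 / (4 * real N)"
  have h: "h > 0" "2 * real N * h = 1 / 2" using assms by (auto simp: h_def)
  have s: "omega_shift N i = (if i < 2 * N then real i * h else real N / 2 + real (i - 2 * N) * h)" for i
    by (simp add: omega_shift_def h_def)
  have up: "real i * h + h \<le> 1/2" if "i < 2 * N" for i
  proof -
    have "(real i + 1) * h \<le> (2 * real N) * h" using that h by (intro mult_right_mono) auto
    then show ?thesis using h by (simp add: algebra_simps)
  qed
  have N2: "real N / 2 \<ge> 1 / 2" using assms by simp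
  show "Omega N = (\<Union>i\<in>{..<4*N}. {omega_shift N i..<omega_shift N i + 1 / (4 * real N)})"
    unfolding h_def[symmetric]
  proof (intro subset_antisym subsetI)
    fix x assume "x \<in> Omega N"
    then consider "0 \<le> x" "x < 1/2" | "real N / 2 \<le> x" "x < real N / 2 + 1/2"
      by (auto simp: Omega_def add_divide_distrib)
    then show "x \<in> (\<Union>i\<in>{..<4*N}. {omega_shift N i..<omega_shift N i + h})"
    proof cases
      case 1
      then obtain t where "t < 2 * N" "real t * h \<le> x" "x < real t * h + h"
        using interval_grid[of h x "2 * N"] h by auto
      then show ?thesis by (intro UN_I[of t]) (auto simp: s)
    next
      case 2
      then obtain t where "t < 2 * N" "real t * h \<le> x - real N / 2" "x - real N / 2 < real t * h + h"
        using interval_grid[of h "x - real N / 2" "2 * N"] h by auto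
      then show ?thesis by (intro UN_I[of "2 * N + t"]) (auto simp: s)
    qed
  next
    fix x assume "x \<in> (\<Union>i\<in>{..<4*N}. {omega_shift N i..<omega_shift N i + h})"
    then obtain i where i: "i < 4 * N" "omega_shift N i \<le> x" "x < omega_shift N i + h" by auto
    show "x \<in> Omega N"
    proof (cases "i < 2 * N")
      case True
      have "0 \<le> real i * h" using h by simp
      also have "real i * h \<le> x" using i True by (simp add: s)
      finally have "0 \<le> x" "x < 1/2" using i up[OF True] True by (simp_all add: s)
      then show ?thesis by (simp add: Omega_def)
    next
      case False
      then have "i - 2 * N < 2 * N" using i by simp
      note up[OF this]
      moreover have "0 \<le> real (i - 2 * N) * h" using h by simp
      moreover have "real N / 2 + real (i - 2 * N) * h \<le> x" "x < real N / 2 + real (i - 2 * N) * h + h"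
        using i False by (simp_all add: s)
      ultimately have "real N / 2 \<le> x" "x < real N / 2 + 1 / 2" by linarith+
      then show ?thesis by (simp add: Omega_def add_divide_distrib)
    qed
  qed
  \<comment> \<open>Disjointness comes from the ordering of the tiles; across index 2N the first
    block ends by 1/2 and the second starts at N/2 >= 1/2.\<close>
  have sep: "omega_shift N i + h \<le> omega_shift N j" if "i < j" "j < 4 * N" for i j
  proof -
    have st: "real a * h + h \<le> real b * h" if "a < b" for a b
    proof -
      have "(real a + 1) * h \<le> real b * h" using that h by (intro mult_right_mono) auto
      then show ?thesis by (simp add: algebra_simps)
    qed
    consider "j < 2 * N" | "i < 2 * N" "\<not> j < 2 * N" | "\<not> i < 2 * N" by linarith
    then show ?thesis
    proof cases
      case 1
      then show ?thesis using st[of i j] that by (simp add: s)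
    next
      case 2
      have "real i * h + h \<le> 1 / 2" by (rule up[OF 2(1)])
      also have "\<dots> \<le> real N / 2 + real (j - 2 * N) * h"
        using N2 mult_nonneg_nonneg[of "real (j - 2 * N)" h] h(1) by linarith
      finally show ?thesis using 2 by (simp add: s)
    next
      case 3
      then show ?thesis using st[of "i - 2 * N" "j - 2 * N"] that by (simp add: s)
    qed
  qed
  show "{omega_shift N i..<omega_shift N i + 1 / (4 * real N)} \<inter> {omega_shift N j..<omega_shift N j + 1 / (4 * real N)} = {}"
    if "i \<in> {..<4*N}" "j \<in> {..<4*N}" "i \<noteq> j" for i j
    unfolding h_def[symmetric] using sep[of i j] sep[of j i] that by (cases "i < j") force+
qed simp

section \<open>Exponentials with frequencies in \<open>Lam N r\<close>\<close>

lemma bounded_Omega: "bounded (Omega N)"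
  unfolding Omega_def by (intro bounded_Un[THEN iffD2] conjI) auto

lemma borel_Omega [measurable]: "Omega N \<in> sets borel"
  unfolding Omega_def by measurable

lemma Lam_eq: "Lam N r = range (\<lambda>n::int. 2 * of_int n) \<union> range (\<lambda>n::int. of_int r / real N + 2 * of_int n)"
proof (intro subset_antisym subsetI)
  fix l assume "l \<in> Lam N r"
  then show "l \<in> range (\<lambda>n::int. 2 * of_int n) \<union> range (\<lambda>n::int. of_int r / real N + 2 * of_int n)"
    by (auto simp: Lam_def)
next
  fix l assume "l \<in> range (\<lambda>n::int. 2 * of_int n) \<union> range (\<lambda>n::int. of_int r / real N + 2 * of_int n)"
  then obtain n where "l = 0 + 2 * of_int n \<or> l = of_int r / real N + 2 * of_int n" by auto
  then show "l \<in> Lam N r" unfolding Lam_def by blast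
qed

lemma cis_even_period: "cis (2 * pi * (2 * of_int n) * (real N / 2)) = 1"
  using cis_multiple_2pi[of "of_int (n * int N)"] by (simp add: mult_ac)

lemma cis_odd_period:
  assumes "odd r" "N \<ge> 1"
  shows "cis (2 * pi * (of_int r / real N + 2 * of_int n) * (real N / 2)) = -1"
proof -
  obtain q where q: "r = 2 * q + 1" using \<open>odd r\<close> by (auto elim: oddE)
  have "2 * pi * (of_int r / real N + 2 * of_int n) * (real N / 2) = pi * (of_int r + 2 * of_int n * real N)"
    using assms by (simp add: field_simps)
  also have "\<dots> = pi + 2 * pi * of_int (q + n * int N)"
    by (simp add: q algebra_simps)
  finally have "cis (2 * pi * (of_int r / real N + 2 * of_int n) * (real N / 2)) = cis pi * cis (2 * pi * of_int (q + n * int N))"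
    by (simp only: cis_mult)
  then show ?thesis by (simp only: cis_multiple_2pi[OF Ints_of_int]) simp
qed

text \<open>Shifting by \<open>N/2\<close> multiplies the exponential of frequency \<open>l\<close> by \<open>1\<close> if \<open>l\<close> is an even integer and by \<open>-1\<close> on
  the other coset.  So the coefficients of \<open>f\<close> are those of \<open>f(x) + f(x + N/2)\<close> and of a modulation of
  \<open>f(x) - f(x + N/2)\<close> on \<open>[0, 1/2)\<close>.\<close>

lemma orthonormal_basis_Omega:
  assumes N: "N \<ge> 1" and r: "odd r"
  shows "orthonormal_basis (leb_on (Omega N)) (\<lambda>l x. cis (2 * pi * l * x)) (Lam N r)"
proof -
  interpret tiling "Omega N" "{..<2::nat}" "\<lambda>j. real j * (real N / 2)" "1/2"
    by (rule tiling_Omega_halves[OF N])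
  interpret F: finite_measure "leb_on (Omega N)" by (intro finite_measure_leb_on bounded_Omega) auto
  interpret H: finite_measure "leb_on {0..<1/2}" by (intro finite_measure_leb_on) auto
  have two: "(\<Sum>j\<in>{..<2::nat}. g j) = g 0 + g 1" for g :: "nat \<Rightarrow> complex"
    by (simp add: numeral_2_eq_2)
  have sq: "sq_integrable (leb_on (Omega N)) (\<lambda>x. cis (2 * pi * l * x))" for l
    using sq_integrable_cis[OF borel_Omega bounded_Omega, where c=1] by simp
  have split: "(\<integral>x. f x * cnj (cis (2 * pi * l * x)) \<partial>leb_on (Omega N)) =
     (\<integral>x. (f x + cnj (cis (2 * pi * l * (real N / 2))) * f (x + real N / 2)) * cnj (cis (2 * pi * l * x)) \<partial>leb_on {0..<1/2})"
    if "sq_integrable (leb_on (Omega N)) f" for f l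
  proof (subst integral_tiling[OF sq_integrable_inner[OF that sq]], unfold two, rule Bochner_Integration.integral_cong[OF refl])
    fix x
    have "cis (2 * pi * l * (x + 1 * (real N / 2))) = cis (2 * pi * l * x) * cis (2 * pi * l * (real N / 2))"
      by (simp add: cis_mult algebra_simps)
    then show "f (x + real 0 * (real N / 2)) * cnj (cis (2 * pi * l * (x + real 0 * (real N / 2)))) +
         f (x + real 1 * (real N / 2)) * cnj (cis (2 * pi * l * (x + real 1 * (real N / 2)))) =
         (f x + cnj (cis (2 * pi * l * (real N / 2))) * f (x + real N / 2)) * cnj (cis (2 * pi * l * x))"
      by (simp add: algebra_simps)
  qed
  define \<sigma> where "\<sigma> l = cis (2 * pi * l * (real N / 2))" for l
  \<comment> \<open>The factor is 2 when both frequencies lie in the same coset and 0 otherwise.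
    Within a coset the differences are even integers, and orthogonality is that of the 1/2-periodic
    exponentials.\<close>
  have orth0: "(\<integral>x. cis (2 * pi * l * x) * cnj (cis (2 * pi * l' * x)) \<partial>leb_on (Omega N))
      = (1 + \<sigma> l * cnj (\<sigma> l')) * (\<integral>x. cis (2 * pi * (l - l') * x) \<partial>leb_on {0..<1/2})" for l l'
  proof -
    have "(cis (2 * pi * l * x) + cnj (\<sigma> l') * cis (2 * pi * l * (x + real N / 2))) * cnj (cis (2 * pi * l' * x))
      = (1 + \<sigma> l * cnj (\<sigma> l')) * cis (2 * pi * (l - l') * x)" for x
    proof -
      have "cis (2 * pi * l * (x + real N / 2)) = cis (2 * pi * l * x) * \<sigma> l"
        by (simp add: \<sigma>_def cis_mult algebra_simps)
      moreover have "cis (2 * pi * l * x) * cnj (cis (2 * pi * l' * x)) = cis (2 * pi * (l - l') * x)"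
        by (simp add: cis_cnj cis_mult algebra_simps)
      ultimately show ?thesis by (simp add: algebra_simps)
    qed
    then show ?thesis unfolding split[OF sq] \<sigma>_def[symmetric] by simp
  qed
  have half: "(\<integral>x. cis (2 * pi * (2 * of_int n) * x) \<partial>leb_on {0..<1/2}) = (if n = 0 then 1/2 else 0)" for n
    using integral_cis_period[of "1/2" n] by (simp add: mult_ac)
  show ?thesis
  proof
    show "sq_integrable (leb_on (Omega N)) (\<lambda>x. cis (2 * pi * l * x))" for l by (rule sq)
  next
    have rep: "\<exists>(a::bool) (n::int). l = (if a then of_int r / real N else 0) + 2 * of_int n" if "l \<in> Lam N r" for l
    proof -
      from that obtain n :: int where "l = 2 * of_int n \<or> l = of_int r / real N + 2 * of_int n"
        unfolding Lam_eq by auto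
      then show ?thesis
      proof
        assume "l = 2 * of_int n"
        then show ?thesis by (intro exI[of _ False] exI[of _ n]) simp
      next
        assume "l = of_int r / real N + 2 * of_int n"
        then show ?thesis by (intro exI[of _ True] exI[of _ n]) simp
      qed
    qed
    fix l l' assume "l \<in> Lam N r" "l' \<in> Lam N r"
    with rep obtain a b :: bool and n n' :: int
      where l: "l = (if a then of_int r / real N else 0) + 2 * of_int n"
        and l': "l' = (if b then of_int r / real N else 0) + 2 * of_int n'"
      by blast
    have \<sigma>: "\<sigma> l = (if a then -1 else 1)" "\<sigma> l' = (if b then -1 else 1)"
      unfolding \<sigma>_def l l'
      by (cases a; simp only: if_True if_False add_0 cis_even_period cis_odd_period[OF r N])
        (cases b; simp only: if_True if_False add_0 cis_even_period cis_odd_period[OF r N])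
    show "(\<integral>x. cis (2 * pi * l * x) * cnj (cis (2 * pi * l' * x)) \<partial>leb_on (Omega N)) = of_bool (l = l')"
    proof (cases "a = b")
      case True
      then have "l - l' = 2 * of_int (n - n')" by (simp add: l l')
      moreover have "l = l' \<longleftrightarrow> n = n'" using True by (simp add: l l')
      ultimately show ?thesis unfolding orth0 \<sigma> using half[of "n - n'"] True by simp
    next
      case False
      have "l \<noteq> l'" using \<sigma> False by (auto split: if_splits)
      then show ?thesis unfolding orth0 \<sigma> using False by auto
    qed
  next
    fix f assume f: "sq_integrable (leb_on (Omega N)) f"
      and f0: "\<And>l. l \<in> Lam N r \<Longrightarrow> (\<integral>x. f x * cnj (cis (2 * pi * l * x)) \<partial>leb_on (Omega N)) = 0"
    have i0: "integrable (leb_on {0..<1/2}) f" and i1: "integrable (leb_on {0..<1/2}) (\<lambda>x. f (x + real N / 2))"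
      using H.sq_integrable_integrable[OF sq_integrable_tiling[OF f, of 0]]
        H.sq_integrable_integrable[OF sq_integrable_tiling[OF f, of 1]] by auto
    have sum0: "AE x in leb_on {0..<1/2}. f x + f (x + real N / 2) = 0"
    proof (rule fourier_uniqueness_interval)
      fix n :: int
      have "2 * of_int (-n) \<in> Lam N r" unfolding Lam_eq by blast
      from f0[OF this] split[OF f, of "2 * of_int (-n)"]
      show "(\<integral>x. (f x + f (x + real N / 2)) * cis (2 * pi * of_int n * x / (1/2)) \<partial>leb_on {0..<1/2}) = 0"
        unfolding cis_even_period by (simp add: cis_cnj mult_ac)
    qed (use i0 i1 in auto)
    \<comment> \<open>Modulation by -r/N moves the second coset onto the even integers, so the
      uniqueness lemma on [0, 1/2) applies to the difference as well.\<close>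
    define g where "g x = (f x - f (x + real N / 2)) * cis (- (2 * pi * (of_int r / real N) * x))" for x
    have [measurable]: "(\<lambda>x. cis (- (2 * pi * (of_int r / real N) * x))) \<in> borel_measurable (leb_on {0..<1/2})"
      by (intro measurable_leb_on) measurable
    have gi: "integrable (leb_on {0..<1/2}) g"
    proof (rule Bochner_Integration.integrable_bound)
      show "integrable (leb_on {0..<1/2}) (\<lambda>x. f x - f (x + real N / 2))" using i0 i1 by simp
      show "g \<in> borel_measurable (leb_on {0..<1/2})"
        unfolding g_def using borel_measurable_integrable[OF i0] borel_measurable_integrable[OF i1] by measurable
    qed (simp add: g_def norm_mult)
    have diff0: "AE x in leb_on {0..<1/2}. g x = 0"
    proof (rule fourier_uniqueness_interval)
      fix n :: int
      have "of_int r / real N + 2 * of_int (-n) \<in> Lam N r" unfolding Lam_eq by blast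
      from f0[OF this] split[OF f, of "of_int r / real N + 2 * of_int (-n)"]
      have "(\<integral>x. (f x - f (x + real N / 2)) * cnj (cis (2 * pi * (of_int r / real N + 2 * of_int (-n)) * x)) \<partial>leb_on {0..<1/2}) = 0"
        unfolding cis_odd_period[OF r N] by simp
      moreover have "g x * cis (2 * pi * of_int n * x / (1/2)) = (f x - f (x + real N / 2)) * cnj (cis (2 * pi * (of_int r / real N + 2 * of_int (-n)) * x))" for x
        by (simp add: g_def cis_cnj cis_mult mult.assoc algebra_simps)
      ultimately show "(\<integral>x. g x * cis (2 * pi * of_int n * x / (1/2)) \<partial>leb_on {0..<1/2}) = 0" by (simp only:)
    qed (use gi in auto)
    have "AE x in leb_on {0..<1/2}. f x = 0 \<and> f (x + real N / 2) = 0"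
      using sum0 diff0
    proof eventually_elim
      case (elim x)
      then have eq: "f x = f (x + real N / 2)" by (auto simp: g_def)
      with elim(1) have "2 * f (x + real N / 2) = 0" by simp
      with eq show ?case by simp
    qed
    moreover have "{..<2::nat} = {0, 1}" by auto
    ultimately show "AE x in leb_on (Omega N). f x = 0"
      unfolding AE_tiling by auto
  qed
qed

section \<open>The Fourier transform and the coefficients of the Gabor system\<close>

lemma has_sum_sum_finite:
  fixes f :: "'k \<Rightarrow> 'a \<Rightarrow> 'b::topological_comm_monoid_add"
  assumes "finite K" "\<And>k. k \<in> K \<Longrightarrow> (f k has_sum S k) A"
  shows "((\<lambda>x. \<Sum>k\<in>K. f k x) has_sum (\<Sum>k\<in>K. S k)) A"
  using assms by (induction K) (auto intro!: has_sum_add)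

lemma norm_vec_power2: "(norm (v :: complex^'s))\<^sup>2 = (\<Sum>k\<in>UNIV. (cmod (v $h k))\<^sup>2)"
  by (simp add: norm_vec_def L2_set_def sum_nonneg)

lemma borel_measurable_vec_nth [measurable]: "(\<lambda>v. v $h k) \<in> borel_measurable (borel :: (complex^'s) measure)"
  by (intro borel_measurable_continuous_onI linear_continuous_on bounded_linear_vec_nth)

lemma borel_measurable_vec_lambda:
  fixes f :: "'s::finite \<Rightarrow> 'a \<Rightarrow> complex"
  assumes [measurable]: "\<And>k. f k \<in> borel_measurable M"
  shows "(\<lambda>x. vec_lambda (\<lambda>k. f k x)) \<in> borel_measurable M"
  by (subst borel_measurable_euclidean_space) (auto simp: Basis_vec_def inner_axis)

locale exponential_basis =
  fixes Om :: "real set" and L :: "real set"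
  assumes Om [measurable]: "Om \<in> sets borel"
    and basis: "orthonormal_basis (leb_on Om) (\<lambda>l x. cis (2 * pi * l * x)) L"
begin

sublocale orthonormal_basis "leb_on Om" "\<lambda>l x. cis (2 * pi * l * x)" L
  by (rule basis)

lemma nn_integral_norm_vec:
  fixes v :: "real \<Rightarrow> complex^'s"
  assumes [measurable]: "v \<in> borel_measurable borel"
  shows "(\<integral>\<^sup>+\<xi>\<in>Om. ennreal ((norm (v \<xi>))\<^sup>2) \<partial>lborel) = (\<Sum>k\<in>UNIV. \<integral>\<^sup>+x. ennreal ((cmod (v x $h k))\<^sup>2) \<partial>leb_on Om)"
proof -
  have [measurable]: "(\<lambda>x. v x $h k) \<in> borel_measurable (leb_on Om)" for k
    by (intro measurable_leb_on) measurable
  have "(\<integral>\<^sup>+\<xi>\<in>Om. ennreal ((norm (v \<xi>))\<^sup>2) \<partial>lborel) = (\<integral>\<^sup>+\<xi>. ennreal ((norm (v \<xi>))\<^sup>2) \<partial>leb_on Om)"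
    by (subst nn_integral_restrict_space) auto
  also have "\<dots> = (\<integral>\<^sup>+\<xi>. (\<Sum>k\<in>UNIV. ennreal ((cmod (v \<xi> $h k))\<^sup>2)) \<partial>leb_on Om)"
    by (simp add: norm_vec_power2 sum_ennreal)
  also have "\<dots> = (\<Sum>k\<in>UNIV. \<integral>\<^sup>+x. ennreal ((cmod (v x $h k))\<^sup>2) \<partial>leb_on Om)"
    by (rule nn_integral_sum) measurable
  finally show ?thesis .
qed

lemma nn_integral_sq_integrable:
  "sq_integrable M f \<Longrightarrow> (\<integral>\<^sup>+x. ennreal ((cmod (f x))\<^sup>2) \<partial>M) = ennreal (\<integral>x. (cmod (f x))\<^sup>2 \<partial>M)"
  by (intro nn_integral_eq_integral) (auto simp: sq_integrable_def)

text \<open>Square norms in C^S are sums over components, and a finite sum of nonnegative quantities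
  tends to 0 exactly when each does. So the vector-valued specification in \<open>fourier\<close>
  splits into scalar ones.\<close>

lemma fourier_spec_iff:
  fixes f :: "real \<Rightarrow> complex^'s" and Z :: "real \<Rightarrow> complex^'s"
  assumes f[measurable]: "f \<in> borel_measurable borel"
  shows "(\<integral>\<^sup>+\<xi>\<in>Om. ennreal ((norm (f \<xi>))\<^sup>2) \<partial>lborel) < \<infinity> \<and>
     ((\<lambda>F. \<integral>\<^sup>+\<xi>\<in>Om. ennreal ((norm (f \<xi> - (\<Sum>l\<in>F. cis (2 * pi * l * \<xi>) *s Z l)))\<^sup>2) \<partial>lborel)
        \<longlongrightarrow> 0) (finite_subsets_at_top L) \<longleftrightarrow>
     (\<forall>k. represents (\<lambda>x. f x $h k) (\<lambda>l. Z l $h k))"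
proof -
  have [measurable]: "(\<lambda>x. f x $h k) \<in> borel_measurable (leb_on Om)" for k
    by (intro measurable_leb_on) measurable
  have diff_meas: "(\<lambda>\<xi>. f \<xi> - (\<Sum>l\<in>F. cis (2 * pi * l * \<xi>) *s Z l)) \<in> borel_measurable borel" for F
  proof -
    have "(\<lambda>\<xi>. cis (2 * pi * l * \<xi>) *s Z l) \<in> borel_measurable borel" for l
      unfolding vector_scalar_mult_def by (intro borel_measurable_vec_lambda) measurable
    then show ?thesis by measurable
  qed
  define A where "A k F = (\<integral>\<^sup>+x. ennreal ((cmod (f x $h k - psum (\<lambda>l. Z l $h k) F x))\<^sup>2) \<partial>leb_on Om)" for k F
  have fin: "(\<integral>\<^sup>+\<xi>\<in>Om. ennreal ((norm (f \<xi>))\<^sup>2) \<partial>lborel) < \<infinity> \<longleftrightarrow> (\<forall>k. sq_integrable (leb_on Om) (\<lambda>x. f x $h k))"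
    by (simp add: nn_integral_norm_vec[OF f] sq_integrable_def integrable_iff_bounded less_top)
  have sum: "(\<integral>\<^sup>+\<xi>\<in>Om. ennreal ((norm (f \<xi> - (\<Sum>l\<in>F. cis (2 * pi * l * \<xi>) *s Z l)))\<^sup>2) \<partial>lborel) = (\<Sum>k\<in>UNIV. A k F)" for F
  proof -
    have "psum (\<lambda>l. Z l $h k) F x = (\<Sum>l\<in>F. cis (2 * pi * l * x) * Z l $h k)" for k x
      unfolding psum_def by (intro sum.cong refl mult.commute)
    then have "(f x - (\<Sum>l\<in>F. cis (2 * pi * l * x) *s Z l)) $h k = f x $h k - psum (\<lambda>l. Z l $h k) F x" for k x
      by simp
    then show ?thesis unfolding nn_integral_norm_vec[OF diff_meas] A_def by (simp only:)
  qed
  have lim1: "(A k \<longlongrightarrow> 0) (finite_subsets_at_top L) \<longleftrightarrow>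
      ((\<lambda>F. \<integral>x. (cmod (f x $h k - psum (\<lambda>l. Z l $h k) F x))\<^sup>2 \<partial>leb_on Om) \<longlongrightarrow> 0) (finite_subsets_at_top L)"
    if "sq_integrable (leb_on Om) (\<lambda>x. f x $h k)" for k
  proof -
    have "\<forall>\<^sub>F F in finite_subsets_at_top L. A k F = ennreal (\<integral>x. (cmod (f x $h k - psum (\<lambda>l. Z l $h k) F x))\<^sup>2 \<partial>leb_on Om)"
      unfolding A_def
      by (intro eventually_finite_subsets_at_top_weakI nn_integral_sq_integrable sq_integrable_diff that psum_sq)
    then have "(A k \<longlongrightarrow> 0) (finite_subsets_at_top L) \<longleftrightarrow>
      ((\<lambda>F. ennreal (\<integral>x. (cmod (f x $h k - psum (\<lambda>l. Z l $h k) F x))\<^sup>2 \<partial>leb_on Om)) \<longlongrightarrow> ennreal 0) (finite_subsets_at_top L)"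
      unfolding ennreal_0 by (rule tendsto_cong)
    also have "\<dots> \<longleftrightarrow> ((\<lambda>F. \<integral>x. (cmod (f x $h k - psum (\<lambda>l. Z l $h k) F x))\<^sup>2 \<partial>leb_on Om) \<longlongrightarrow> 0) (finite_subsets_at_top L)"
      by (rule tendsto_ennreal_iff) auto
    finally show ?thesis .
  qed
  have lim2: "((\<lambda>F. \<Sum>k\<in>UNIV. A k F) \<longlongrightarrow> 0) (finite_subsets_at_top L) \<longleftrightarrow> (\<forall>k. (A k \<longlongrightarrow> 0) (finite_subsets_at_top L))"
  proof
    assume lim: "((\<lambda>F. \<Sum>k\<in>UNIV. A k F) \<longlongrightarrow> 0) (finite_subsets_at_top L)"
    show "\<forall>k. (A k \<longlongrightarrow> 0) (finite_subsets_at_top L)"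
    proof
      fix k
      have "A k F \<le> (\<Sum>k\<in>UNIV. A k F)" for F by (rule member_le_sum) auto
      then show "(A k \<longlongrightarrow> 0) (finite_subsets_at_top L)"
        by (intro tendsto_sandwich[OF _ _ tendsto_const lim] always_eventually) auto
    qed
  next
    assume "\<forall>k. (A k \<longlongrightarrow> 0) (finite_subsets_at_top L)"
    then have "((\<lambda>F. \<Sum>k\<in>UNIV. A k F) \<longlongrightarrow> (\<Sum>k\<in>(UNIV::'s set). 0)) (finite_subsets_at_top L)"
      by (intro tendsto_sum) auto
    then show "((\<lambda>F. \<Sum>k\<in>UNIV. A k F) \<longlongrightarrow> 0) (finite_subsets_at_top L)" by simp
  qed
  show ?thesis
    unfolding sum fin lim2 represents_def using lim1 by blast
qed

lemma ell2_component:
  fixes Z :: "real \<Rightarrow> complex^'s"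
  assumes "Z \<in> ell2 L"
  shows "(\<lambda>l. (cmod (Z l $h k))\<^sup>2) summable_on L"
  using assms unfolding ell2_def mem_Collect_eq
  by (rule summable_on_comparison_test) (auto intro!: member_le_sum)

text \<open>The choice in \<open>fourier\<close> is meaningful only once some function meets the
  specification; Riesz-Fischer in each component supplies one.\<close>

lemma fourier_properties:
  fixes Z :: "real \<Rightarrow> complex^'s"
  assumes Z: "Z \<in> ell2 L"
  shows "fourier L Om Z \<in> borel_measurable borel"
    and "represents (\<lambda>x. fourier L Om Z x $h k) (\<lambda>l. Z l $h k)"
proof -
  define spec where "spec f \<longleftrightarrow> f \<in> borel_measurable lborel \<and>
     (\<integral>\<^sup>+\<xi>\<in>Om. ennreal ((norm (f \<xi>))\<^sup>2) \<partial>lborel) < \<infinity> \<and>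
     ((\<lambda>F. \<integral>\<^sup>+\<xi>\<in>Om. ennreal ((norm (f \<xi> - (\<Sum>l\<in>F. cis (2 * pi * l * \<xi>) *s Z l)))\<^sup>2) \<partial>lborel)
        \<longlongrightarrow> 0) (finite_subsets_at_top L)" for f
  have "\<exists>f. \<forall>k. represents (f k) (\<lambda>l. Z l $h k)"
    by (rule choice) (use riesz_fischer[OF ell2_component[OF Z]] in blast)
  then obtain f where f: "\<And>k. represents (f k) (\<lambda>l. Z l $h k)" by blast
  \<comment> \<open>The component limits are measurable only on \<open>Om\<close>; extending them by
    0 gives the Borel representative that the specification asks for.\<close>
  define g :: "real \<Rightarrow> complex^'s" where "g x = vec_lambda (\<lambda>k. indicator Om x *\<^sub>R f k x)" for x
  have fm: "f k \<in> borel_measurable (leb_on Om)" for k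
    using f[of k] by (auto simp: represents_def sq_integrable_def)
  have gm: "g \<in> borel_measurable borel"
    unfolding g_def using fm by (intro borel_measurable_vec_lambda) (auto simp: borel_measurable_restrict_space_iff)
  have "represents (\<lambda>x. g x $h k) (\<lambda>l. Z l $h k)" for k
  proof -
    have eq: "g x $h k = f k x" if "x \<in> space (leb_on Om)" for x
      using that by (simp add: g_def space_restrict_space)
    have "sq_integrable (leb_on Om) (\<lambda>x. g x $h k) \<longleftrightarrow> sq_integrable (leb_on Om) (f k)"
      unfolding sq_integrable_def using eq
      by (intro conj_cong measurable_cong Bochner_Integration.integrable_cong) auto
    moreover have "(\<integral>x. (cmod (g x $h k - psum (\<lambda>l. Z l $h k) F x))\<^sup>2 \<partial>leb_on Om)
      = (\<integral>x. (cmod (f k x - psum (\<lambda>l. Z l $h k) F x))\<^sup>2 \<partial>leb_on Om)" for F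
      using eq by (intro Bochner_Integration.integral_cong) auto
    ultimately show ?thesis using f[of k] by (simp add: represents_def)
  qed
  then have "spec g" unfolding spec_def using fourier_spec_iff[OF gm, of Z] gm by simp
  then have "spec (Eps spec)" by (rule someI[of spec])
  moreover have "fourier L Om Z = Eps spec" unfolding fourier_def spec_def ..
  ultimately have *: "spec (fourier L Om Z)" by simp
  then show m: "fourier L Om Z \<in> borel_measurable borel" by (simp add: spec_def)
  show "represents (\<lambda>x. fourier L Om Z x $h k) (\<lambda>l. Z l $h k)"
    using * fourier_spec_iff[OF m, of Z] by (simp add: spec_def)
qed

text \<open>\<open>V\<close> enters only through the coefficients of \<open>G\<close>, so a
  modulated translate of a window can be treated by exhibiting a suitable \<open>G\<close>.\<close>

lemma ell2_inner_eq:
  fixes Z V :: "real \<Rightarrow> complex^'s"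
  assumes F: "\<And>k. represents (F k) (\<lambda>l. Z l $h k)"
    and G: "\<And>k. sq_integrable (leb_on Om) (G k)"
    and GV: "\<And>k l. l \<in> L \<Longrightarrow> (\<integral>x. G k x * cnj (cis (2 * pi * l * x)) \<partial>leb_on Om) = V l $h k"
  shows "ell2_inner L Z V = (\<Sum>k\<in>UNIV. \<integral>x. F k x * cnj (G k x) \<partial>leb_on Om)"
proof -
  have "((\<lambda>l. Z l $h k * cnj (V l $h k)) has_sum (\<integral>x. F k x * cnj (G k x) \<partial>leb_on Om)) L" for k
    using represents_inner[OF F G, of k k] GV unfolding inner_cnj by (simp cong: has_sum_cong)
  then have "((\<lambda>l. \<Sum>k\<in>UNIV. Z l $h k * cnj (V l $h k)) has_sum (\<Sum>k\<in>UNIV. \<integral>x. F k x * cnj (G k x) \<partial>leb_on Om)) L"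
    by (intro has_sum_sum_finite) auto
  then show ?thesis unfolding ell2_inner_def by (rule infsumI)
qed

lemma ell2_norm_eq:
  fixes Z :: "real \<Rightarrow> complex^'s"
  assumes F: "\<And>k. represents (F k) (\<lambda>l. Z l $h k)"
  shows "(ell2_norm L Z)\<^sup>2 = (\<Sum>k\<in>UNIV. \<integral>x. (cmod (F k x))\<^sup>2 \<partial>leb_on Om)"
proof -
  have sq: "sq_integrable (leb_on Om) (F k)" for k using F by (simp add: represents_def)
  have "ell2_inner L Z Z = (\<Sum>k\<in>UNIV. \<integral>x. F k x * cnj (F k x) \<partial>leb_on Om)"
    by (intro ell2_inner_eq F sq represents_coeff)
  also have "\<dots> = complex_of_real (\<Sum>k\<in>UNIV. \<integral>x. (cmod (F k x))\<^sup>2 \<partial>leb_on Om)"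
    by (simp only: cmod_power2_complex[symmetric] integral_complex_of_real of_real_sum)
  finally have "Re (ell2_inner L Z Z) = (\<Sum>k\<in>UNIV. \<integral>x. (cmod (F k x))\<^sup>2 \<partial>leb_on Om)"
    by (simp only: Re_complex_of_real)
  then show ?thesis by (simp add: ell2_norm_def sum_nonneg)
qed

end

lemma exponential_basis_Omega:
  assumes "N \<ge> 1" "odd r"
  shows "exponential_basis (Omega N) (Lam N r)"
  by (intro exponential_basis.intro borel_Omega orthonormal_basis_Omega assms)

section \<open>Gabor coefficients and their folding onto [0, 1/(4N))\<close>

lemma ell2_modulation:
  assumes "Z \<in> ell2 L"
  shows "modulation_op a Z \<in> ell2 L"
  using assms by (simp add: ell2_def modulation_op_def norm_mult)

text \<open>Together with \<open>Lam_diff_even\<close> this shows that the translations of the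
  system preserve \<open>Lam N r\<close>, so values outside it never enter.\<close>

lemma Lam_double:
  assumes "N \<ge> 1" "l \<in> Lam N r"
  obtains q :: int where "2 * real N * l = 2 * of_int q"
proof -
  from assms(2) obtain n :: int where "l = 2 * of_int n \<or> l = of_int r / real N + 2 * of_int n"
    unfolding Lam_eq by auto
  then show thesis
  proof
    assume "l = 2 * of_int n"
    then show thesis by (intro that[of "2 * int N * n"]) simp
  next
    assume "l = of_int r / real N + 2 * of_int n"
    then show thesis using assms(1) by (intro that[of "r + 2 * int N * n"]) (simp add: field_simps)
  qed
qed

lemma Lam_diff_even:
  assumes "l \<in> Lam N r"
  shows "l - 2 * of_int q \<in> Lam N r"
proof -
  from assms obtain n :: int where "l = 2 * of_int n \<or> l = of_int r / real N + 2 * of_int n"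
    unfolding Lam_eq by auto
  then have "l - 2 * of_int q = 2 * of_int (n - q) \<or> l - 2 * of_int q = of_int r / real N + 2 * of_int (n - q)"
    by auto
  then show ?thesis unfolding Lam_eq by blast
qed

text \<open>Translation by 2Nl becomes modulation on the Fourier side. Summing over components
  leaves Fourier coefficients of one scalar function on \<open>Omega N\<close>.\<close>

lemma gabor_coefficient:
  fixes Z :: "real \<Rightarrow> complex^'s" and W :: "nat \<Rightarrow> real \<Rightarrow> complex^'s" and N M :: nat and r :: int
  defines "w \<equiv> \<lambda>m j. fourier (Lam N r) (Omega N) (modulation_op (of_nat m / of_nat M) (W j))"
  assumes N: "N \<ge> 1" and r: "odd r" and W: "W j \<in> ell2 (Lam N r)"
    and F: "\<And>k. orthonormal_basis.represents (leb_on (Omega N)) (\<lambda>l x. cis (2 * pi * l * x)) (Lam N r) (F k) (\<lambda>l. Z l $h k)"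
    and l: "l \<in> Lam N r"
  shows "cmod (ell2_inner (Lam N r) Z (gabor_elem N M W m j l)) =
    cmod (\<integral>x. (\<Sum>k\<in>UNIV. F k x * cnj (w m j x $h k)) * cis (- (2 * pi * (2 * real N * l) * x)) \<partial>leb_on (Omega N))"
proof -
  interpret exponential_basis "Omega N" "Lam N r" using N r by (rule exponential_basis_Omega)
  define a where "a = 2 * real N * l"
  obtain q :: int where q: "a = 2 * of_int q" using Lam_double[OF N l] unfolding a_def by blast
  \<comment> \<open>The phase from exchanging modulation and translation: the Gabor element at l' is
    \<kappa> times \<open>V (l' - a)\<close>.\<close>
  define \<kappa> where "\<kappa> = cis (2 * pi * (real m / real M) * a)"
  have \<kappa>1: "cmod \<kappa> = 1" by (simp add: \<kappa>_def)
  define V where "V = modulation_op (real m / real M) (W j)"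
  have V: "V \<in> ell2 (Lam N r)" unfolding V_def by (rule ell2_modulation[OF W])
  have w: "represents (\<lambda>x. w m j x $h k) (\<lambda>l. V l $h k)" for k
    unfolding w_def V_def[symmetric] by (rule fourier_properties[OF V])
  then have wsq: "sq_integrable (leb_on (Omega N)) (\<lambda>x. w m j x $h k)" for k by (simp add: represents_def)
  have Fsq: "sq_integrable (leb_on (Omega N)) (F k)" for k using F by (simp add: represents_def)
  define G where "G k x = \<kappa> * cis (2 * pi * a * x) * w m j x $h k" for k x
  have [measurable]: "(\<lambda>x. \<kappa> * cis (2 * pi * a * x)) \<in> borel_measurable (leb_on (Omega N))"
    by (intro measurable_leb_on) measurable
  have Gsq: "sq_integrable (leb_on (Omega N)) (G k)" for k
    unfolding G_def by (rule sq_integrable_mult_bounded[OF wsq, where K=1]) (auto simp: norm_mult \<kappa>1)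
  have "ell2_inner (Lam N r) Z (gabor_elem N M W m j l) = (\<Sum>k\<in>UNIV. \<integral>x. F k x * cnj (G k x) \<partial>leb_on (Omega N))"
  proof (rule ell2_inner_eq[OF F Gsq])
    fix k l' assume l': "l' \<in> Lam N r"
    have "G k x * cnj (cis (2 * pi * l' * x)) = \<kappa> * (w m j x $h k * cnj (cis (2 * pi * (l' - a) * x)))" for x
      by (simp add: G_def cis_cnj cis_mult algebra_simps)
    then have "(\<integral>x. G k x * cnj (cis (2 * pi * l' * x)) \<partial>leb_on (Omega N)) = \<kappa> * V (l' - a) $h k"
      using represents_coeff[OF w, of "l' - a"] Lam_diff_even[OF l', of q] by (simp add: q)
    also have "\<dots> = gabor_elem N M W m j l l' $h k"
    proof -
      have "cis (2 * pi * (real m / real M) * l') = \<kappa> * cis (2 * pi * (real m / real M) * (l' - a))"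
        unfolding \<kappa>_def cis_mult by (rule arg_cong[where f=cis]) (simp add: right_diff_distrib)
      then show ?thesis
        by (simp add: V_def gabor_elem_def modulation_op_def shift_op_def a_def[symmetric])
    qed
    finally show "(\<integral>x. G k x * cnj (cis (2 * pi * l' * x)) \<partial>leb_on (Omega N)) = gabor_elem N M W m j l l' $h k" .
  qed
  also have "\<dots> = (\<integral>x. (\<Sum>k\<in>UNIV. F k x * cnj (G k x)) \<partial>leb_on (Omega N))"
    by (intro Bochner_Integration.integral_sum[symmetric] sq_integrable_inner Fsq Gsq)
  also have "\<dots> = (\<integral>x. cnj \<kappa> * ((\<Sum>k\<in>UNIV. F k x * cnj (w m j x $h k)) * cis (- (2 * pi * a * x))) \<partial>leb_on (Omega N))"
    by (intro Bochner_Integration.integral_cong)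
      (auto simp: G_def cis_cnj sum_distrib_left sum_distrib_right mult_ac)
  finally show ?thesis by (simp add: norm_mult \<kappa>1 a_def)
qed

text \<open>\<open>b = 0\<close> belongs to the frequencies in the even integers and \<open>b = 1\<close> to those in the other coset;
  in the matrices they correspond to the columns \<open>colA\<close> and \<open>colB\<close>.\<close>

definition folded :: "nat \<Rightarrow> int \<Rightarrow> (real \<Rightarrow> complex) \<Rightarrow> nat \<Rightarrow> real \<Rightarrow> complex" where
  "folded N r h b x = (\<Sum>i<4*N. h (x + omega_shift N i) * cis (- (real b * (4 * pi * of_int r * (x + omega_shift N i)))))"

text \<open>4N times any of the shifts is an integer, since N/2 contributes 2N^2; frequencies in 4NZ
  therefore do not see the shift.\<close>

lemma cis_omega_shift:
  assumes "N \<ge> 1"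
  shows "cis (- (2 * pi * (4 * real N * of_int n) * (x + omega_shift N i))) = cis (- (2 * pi * of_int n * x / (1 / (4 * real N))))"
proof -
  have "\<exists>q::int. 4 * real N * omega_shift N i = of_int q"
  proof (cases "i < 2 * N")
    case True
    then show ?thesis using assms by (intro exI[of _ "int i"]) (simp add: omega_shift_def)
  next
    case False
    have "4 * real N * (real N / 2 + y / (4 * real N)) = 2 * real N * real N + y" for y
      using assms by (simp add: field_simps)
    with False have "4 * real N * omega_shift N i = 2 * real N * real N + real (i - 2 * N)"
      by (simp only: omega_shift_def if_False)
    then show ?thesis by (intro exI[of _ "2 * int N * int N + int (i - 2 * N)"]) simp
  qed
  then obtain q :: int where q: "4 * real N * omega_shift N i = of_int q" ..
  have "- (2 * pi * (4 * real N * of_int n) * (x + omega_shift N i)) = - (2 * pi * of_int n * x / (1 / (4 * real N))) - 2 * pi * of_int n * (4 * real N * omega_shift N i)"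
    by (simp add: algebra_simps)
  also have "\<dots> = - (2 * pi * of_int n * x / (1 / (4 * real N))) + 2 * pi * of_int (- (n * q))"
    unfolding q by simp
  finally show ?thesis
    by (simp only: cis_mult[symmetric] cis_multiple_2pi[OF Ints_of_int] mult_1_right)
qed

text \<open>The numbers 2Nl run through 4Nn for l = 2n and through 2r + 4Nn for l = r/N + 2n. Adding
  up the tiles turns each class into the full set of Fourier coefficients of one folded function on
  an interval of length 1/(4N).\<close>

lemma folded_parseval:
  assumes N: "N \<ge> 1" and r: "odd r" and h: "sq_integrable (leb_on (Omega N)) h"
  shows "((\<lambda>l. (cmod (\<integral>x. h x * cis (- (2 * pi * (2 * real N * l) * x)) \<partial>leb_on (Omega N)))\<^sup>2) has_sum
    (1 / (4 * real N)) * (\<integral>x. (cmod (folded N r h 0 x))\<^sup>2 + (cmod (folded N r h 1 x))\<^sup>2 \<partial>leb_on {0..<1 / (4 * real N)})) (Lam N r)"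
    and "sq_integrable (leb_on {0..<1 / (4 * real N)}) (folded N r h b)"
proof -
  define d where "d = 1 / (4 * real N)"
  have d: "d > 0" using N by (simp add: d_def)
  interpret tiling "Omega N" "{..<4*N}" "omega_shift N" d
    unfolding d_def by (rule tiling_Omega_fine[OF N])
  interpret finite_measure "leb_on (Omega N)" by (intro finite_measure_leb_on bounded_Omega) auto
  have sq: "sq_integrable (leb_on {0..<d}) (folded N r h b)" for b
    unfolding folded_def
  proof (rule sq_integrable_sum)
    fix i assume "i \<in> {..<4*N}"
    have *: "sq_integrable (leb_on (Omega N)) (\<lambda>x. cis (- (real b * (4 * pi * of_int r * x))) * h x)"
      by (rule sq_integrable_mult_bounded[OF h, where K=1]) (auto intro!: measurable_leb_on)
    from sq_integrable_tiling[OF * \<open>i \<in> _\<close>]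
    show "sq_integrable (leb_on {0..<d}) (\<lambda>x. h (x + omega_shift N i) * cis (- (real b * (4 * pi * of_int r * (x + omega_shift N i)))))"
      by (simp add: mult.commute)
  qed
  then show "sq_integrable (leb_on {0..<1 / (4 * real N)}) (folded N r h b)" by (simp add: d_def)
  have coeff: "(\<integral>x. h x * cis (- (2 * pi * a * x)) \<partial>leb_on (Omega N)) =
      (\<integral>x. folded N r h b x * cis (- (2 * pi * of_int n * x / d)) \<partial>leb_on {0..<d})"
    if a: "a = real b * (2 * of_int r) + 4 * real N * of_int n" for a b and n :: int
  proof -
    have "sq_integrable (leb_on (Omega N)) (\<lambda>x. cis (- (2 * pi * a * x)) * h x)"
      by (rule sq_integrable_mult_bounded[OF h, where K=1]) (auto intro!: measurable_leb_on)
    then have "integrable (leb_on (Omega N)) (\<lambda>x. h x * cis (- (2 * pi * a * x)))"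
      using sq_integrable_integrable by (simp add: mult.commute)
    then have "(\<integral>x. h x * cis (- (2 * pi * a * x)) \<partial>leb_on (Omega N)) =
       (\<integral>x. (\<Sum>i<4*N. h (x + omega_shift N i) * cis (- (2 * pi * a * (x + omega_shift N i)))) \<partial>leb_on {0..<d})"
      by (rule integral_tiling)
    also have "\<dots> = (\<integral>x. folded N r h b x * cis (- (2 * pi * of_int n * x / d)) \<partial>leb_on {0..<d})"
    proof (rule Bochner_Integration.integral_cong[OF refl])
      fix x
      have "cis (- (2 * pi * a * (x + omega_shift N i))) = cis (- (real b * (4 * pi * of_int r * (x + omega_shift N i)))) * cis (- (2 * pi * of_int n * x / d))" for i
      proof -
        have "- (2 * pi * a * (x + omega_shift N i)) = - (real b * (4 * pi * of_int r * (x + omega_shift N i))) + - (2 * pi * (4 * real N * of_int n) * (x + omega_shift N i))"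
          by (simp add: a algebra_simps)
        then show ?thesis unfolding d_def by (simp only: cis_mult[symmetric] cis_omega_shift[OF N])
      qed
      then show "(\<Sum>i<4*N. h (x + omega_shift N i) * cis (- (2 * pi * a * (x + omega_shift N i)))) = folded N r h b x * cis (- (2 * pi * of_int n * x / d))"
        by (simp add: folded_def sum_distrib_right mult.assoc)
    qed
    finally show ?thesis .
  qed
  define c where "c l = (cmod (\<integral>x. h x * cis (- (2 * pi * (2 * real N * l) * x)) \<partial>leb_on (Omega N)))\<^sup>2" for l
  define S where "S b = d * (\<integral>x. (cmod (folded N r h b x))\<^sup>2 \<partial>leb_on {0..<d})" for b
  define L0 L1 where "L0 = range (\<lambda>n::int. 2 * real_of_int n)" and "L1 = range (\<lambda>n::int. of_int r / real N + 2 * of_int n)"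
  have "(c has_sum S 0) L0"
    unfolding L0_def
  proof (subst has_sum_reindex)
    show "((c \<circ> (\<lambda>n::int. 2 * real_of_int n)) has_sum S 0) UNIV"
      using parseval_interval[OF d sq[of 0]] coeff[of "2 * real N * (2 * of_int n)" 0 n for n]
      by (simp add: c_def S_def o_def)
  qed (auto simp: inj_on_def)
  moreover have "(c has_sum S 1) L1"
    unfolding L1_def
  proof (subst has_sum_reindex)
    have "2 * real N * (of_int r / real N + 2 * of_int n) = real 1 * (2 * of_int r) + 4 * real N * of_int n" for n :: int
      using N by (simp add: field_simps)
    from coeff[OF this]
    have "c (of_int r / real N + 2 * of_int n) = (cmod (\<integral>x. folded N r h 1 x * cis (- (2 * pi * of_int n * x / d)) \<partial>leb_on {0..<d}))\<^sup>2" for n :: int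
      unfolding c_def by simp
    then show "((c \<circ> (\<lambda>n::int. of_int r / real N + 2 * of_int n)) has_sum S 1) UNIV"
      using parseval_interval[OF d sq[of 1]] by (simp add: S_def o_def)
  qed (auto simp: inj_on_def)
  moreover have "L0 \<inter> L1 = {}"
  proof -
    \<comment> \<open>A common element of the two cosets would make \<open>r\<close> a multiple of
      2N, hence even.\<close>
    have False if "2 * real_of_int n = of_int r / real N + 2 * of_int n'" for n n' :: int
    proof -
      have "of_int r = real_of_int (2 * int N * (n - n'))" using that N by (simp add: field_simps)
      then have "r = 2 * int N * (n - n')" by (simp only: of_int_eq_iff)
      then show False using r by simp
    qed
    then show ?thesis by (auto simp: L0_def L1_def)
  qed
  ultimately have "(c has_sum (S 0 + S 1)) (L0 \<union> L1)" by (rule has_sum_Un_disjoint)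
  moreover have "S 0 + S 1 = d * (\<integral>x. (cmod (folded N r h 0 x))\<^sup>2 + (cmod (folded N r h 1 x))\<^sup>2 \<partial>leb_on {0..<d})"
    using sq[of 0] sq[of 1] by (simp add: S_def sq_integrable_def distrib_left)
  ultimately show "((\<lambda>l. (cmod (\<integral>x. h x * cis (- (2 * pi * (2 * real N * l) * x)) \<partial>leb_on (Omega N)))\<^sup>2) has_sum
    (1 / (4 * real N)) * (\<integral>x. (cmod (folded N r h 0 x))\<^sup>2 + (cmod (folded N r h 1 x))\<^sup>2 \<partial>leb_on {0..<1 / (4 * real N)})) (Lam N r)"
    by (simp add: Lam_eq c_def[abs_def] L0_def L1_def d_def)
qed

section \<open>The frame inequality as a pointwise inequality\<close>

lemma has_sum_finite_Times:
  fixes f :: "'a \<Rightarrow> 'b \<Rightarrow> real"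
  assumes A: "finite A" and f: "\<And>x. x \<in> A \<Longrightarrow> (f x has_sum g x) B"
    and nonneg: "\<And>x y. 0 \<le> f x y"
  shows "((\<lambda>(x, y). f x y) has_sum (\<Sum>x\<in>A. g x)) (A \<times> B)"
proof -
  have "(\<lambda>(x, y). f x y) summable_on A \<times> B"
    by (rule summable_on_SigmaI[where g=g]) (use A f nonneg in auto)
  then show ?thesis
    by (intro has_sum_SigmaI[where g=g] has_sum_finite[OF A]) (use f in auto)
qed

section \<open>Entries of the adjoint matrices applied to vectors\<close>

lemma sum_lessThan_double: "(\<Sum>i<2 * n. f i) = (\<Sum>j<n. f (2 * j) + f (2 * j + 1))"
  for f :: "nat \<Rightarrow> 'a::comm_monoid_add"
  by (induction n) (simp_all add: add.assoc)

lemma length_concat_pairs: "length (concat (map (\<lambda>j. [f j, g j]) [0..<n])) = 2 * n"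
  by (induction n) auto

lemma nth_concat_pairs:
  "j < n \<Longrightarrow> concat (map (\<lambda>j. [f j, g j]) [0..<n]) ! (2 * j) = f j \<and>
    concat (map (\<lambda>j. [f j, g j]) [0..<n]) ! (2 * j + 1) = g j"
proof (induction n)
  case (Suc n)
  show ?case
  proof (cases "j < n")
    case True
    then show ?thesis using Suc.IH by (simp add: nth_append length_concat_pairs)
  next
    case False
    then have "j = n" using Suc.prems by simp
    then show ?thesis by (simp add: nth_append length_concat_pairs)
  qed
qed simp

lemma cvec_norm_power2: "(cvec_norm v)\<^sup>2 = (\<Sum>i<dim_vec v. (cmod (v $ i))\<^sup>2)"
  by (simp add: cvec_norm_def L2_set_def sum_nonneg)

lemma mat_adjoint_mat_of_cols_mult:
  fixes vs :: "complex Matrix.vec list"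
  assumes vs: "set vs \<subseteq> carrier_vec n" and C: "C \<in> carrier_vec n" and a: "a < length vs"
  shows "(mat_adjoint (mat_of_cols n vs) *\<^sub>v C) $ a = (\<Sum>i<n. cnj (vs ! a $ i) * C $ i)"
    and "dim_vec (mat_adjoint (mat_of_cols n vs) *\<^sub>v C) = length vs"
proof -
  have adj: "mat_adjoint (mat_of_cols n vs) = mat_of_rows n (map conjugate vs)"
    using vs by (simp add: mat_adjoint_def)
  have va: "vs ! a \<in> carrier_vec n" using vs a by auto
  show "dim_vec (mat_adjoint (mat_of_cols n vs) *\<^sub>v C) = length vs" by (simp add: adj)
  have "row (mat_of_rows n (map conjugate vs)) a = conjugate (vs ! a)"
    using a va by (subst mat_of_rows_row) auto
  then have "(mat_adjoint (mat_of_cols n vs) *\<^sub>v C) $ a = conjugate (vs ! a) \<bullet> C"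
    using a by (simp add: adj)
  also have "\<dots> = (\<Sum>i<n. cnj (vs ! a $ i) * C $ i)"
    using C va by (simp add: scalar_prod_def atLeast0LessThan)
  finally show "(mat_adjoint (mat_of_cols n vs) *\<^sub>v C) $ a = (\<Sum>i<n. cnj (vs ! a $ i) * C $ i)" .
qed

lemma colA_index:
  assumes "i < 4 * N"
  shows "colA N r M W j m k \<xi> $ i =
    fourier (Lam N r) (Omega N) (modulation_op (of_nat m / of_nat M) (W j)) (\<xi> + omega_shift N i) $h k"
proof (cases "i < 2 * N")
  case False
  then obtain t where "i = 2 * N + t" by (metis le_add_diff_inverse not_less)
  then show ?thesis using assms by (simp add: colA_def Let_def omega_shift_def add.assoc)
qed (use assms in \<open>simp add: colA_def Let_def omega_shift_def\<close>)

text \<open>In its second half \<open>colB\<close> uses the phase at xi + t/(4N), without N/2. The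
  missing part 4 pi r N/2 is a multiple of 2 pi, so one formula covers both halves.\<close>

lemma colB_index:
  assumes "N \<ge> 1" "i < 4 * N"
  shows "colB N r M W j m k \<xi> $ i = cis (4 * pi * of_int r * (\<xi> + omega_shift N i)) * colA N r M W j m k \<xi> $ i"
proof (cases "i < 2 * N")
  case True
  then show ?thesis by (simp add: colB_def Let_def omega_shift_def)
next
  case False
  have "4 * pi * of_int r * (\<xi> + omega_shift N i) = 4 * pi * of_int r * (\<xi> + real (i - 2 * N) / (4 * real N)) + 2 * pi * of_int (r * int N)"
    using False by (simp add: omega_shift_def algebra_simps)
  then have "cis (4 * pi * of_int r * (\<xi> + omega_shift N i)) = cis (4 * pi * of_int r * (\<xi> + real (i - 2 * N) / (4 * real N)))"
    by (simp only: cis_mult[symmetric] cis_multiple_2pi[OF Ints_of_int] mult_1_right)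
  moreover have "colB N r M W j m k \<xi> $ i = cis (4 * pi * of_int r * (\<xi> + real (i - 2 * N) / (4 * real N))) * colA N r M W j m k \<xi> $ (2 * N + (i - 2 * N))"
    using False assms by (simp add: colB_def Let_def)
  moreover have "2 * N + (i - 2 * N) = i" using False by simp
  ultimately show ?thesis by simp
qed

section \<open>The quadratic forms of the system and the frame sum\<close>

locale gabor_setting =
  fixes N M P :: nat and r :: int and W :: "nat \<Rightarrow> real \<Rightarrow> complex^'s::finite" and B0 :: real
  assumes N: "N \<ge> 1" and r: "odd r" and W: "j \<le> P \<Longrightarrow> W j \<in> ell2 (Lam N r)"
    and bounded_fourier: "m < M \<Longrightarrow> j \<le> P \<Longrightarrow> AE \<xi> in leb_on (Omega N).
      norm (fourier (Lam N r) (Omega N) (modulation_op (of_nat m / of_nat M) (W j)) \<xi>) \<le> B0"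
begin

abbreviation "\<Lambda> \<equiv> Lam N r"
abbreviation "\<delta> \<equiv> 1 / (4 * real N)"
abbreviation "\<sigma> \<equiv> omega_shift N"
abbreviation "w m j \<equiv> fourier (Lam N r) (Omega N) (modulation_op (of_nat m / of_nat M) (W j))"

sublocale exponential_basis "Omega N" "Lam N r"
  using N r by (rule exponential_basis_Omega)

sublocale tiling "Omega N" "{..<4*N}" "omega_shift N" "1 / (4 * real N)"
  by (rule tiling_Omega_fine[OF N])

lemma w_measurable: "j \<le> P \<Longrightarrow> w m j \<in> borel_measurable borel"
  by (intro fourier_properties ell2_modulation W)

text \<open>One expression for two uses: with constant \<open>c\<close> it is an entry of the summed
  matrix products, with \<open>c k i\<close> replaced by \<open>F k (x + \<sigma> i)\<close> it is a
  folded function. Only indices below 4N matter, hence the congruence rules.\<close>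

definition column_form :: "('s \<Rightarrow> nat \<Rightarrow> complex) \<Rightarrow> nat \<Rightarrow> nat \<Rightarrow> nat \<Rightarrow> real \<Rightarrow> complex" where
  "column_form c m j b x = (\<Sum>i<4*N. (\<Sum>k\<in>UNIV. c k i * cnj (w m j (x + \<sigma> i) $h k)) *
     cis (- (real b * (4 * pi * of_int r * (x + \<sigma> i)))))"

definition frame_form :: "('s \<Rightarrow> nat \<Rightarrow> complex) \<Rightarrow> real \<Rightarrow> real" where
  "frame_form c x = (\<Sum>m<M. \<Sum>j\<le>P. (cmod (column_form c m j 0 x))\<^sup>2 + (cmod (column_form c m j 1 x))\<^sup>2)"

definition mass :: "('s \<Rightarrow> nat \<Rightarrow> complex) \<Rightarrow> real" where
  "mass c = (\<Sum>k\<in>UNIV. \<Sum>i<4*N. (cmod (c k i))\<^sup>2)"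

lemma column_form_cong: "(\<And>k i. i < 4*N \<Longrightarrow> c k i = c' k i) \<Longrightarrow> column_form c m j b x = column_form c' m j b x"
  unfolding column_form_def by (intro sum.cong refl arg_cong2[where f="(*)"]) auto

lemma frame_form_cong: "(\<And>k i. i < 4*N \<Longrightarrow> c k i = c' k i) \<Longrightarrow> frame_form c x = frame_form c' x"
  unfolding frame_form_def using column_form_cong[of c c'] by simp

lemma mass_cong: "(\<And>k i. i < 4*N \<Longrightarrow> c k i = c' k i) \<Longrightarrow> mass c = mass c'"
  unfolding mass_def by (intro sum.cong refl) auto

text \<open>The columns alternate between \<open>colA\<close> and \<open>colB\<close>, so even
  entries of the product are the forms with \<open>b = 0\<close> and odd ones those with
  \<open>b = 1\<close>; conjugating \<open>colB\<close> gives the negative exponent.\<close>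

lemma frame_form_matM:
  assumes C: "\<And>k. C k \<in> carrier_vec (4 * N)"
  shows "(\<Sum>m\<in>{..<M}. (cvec_norm (finsum_vec TYPE(complex) (2 * (P + 1))
               (\<lambda>k. mat_adjoint (matM N r M P W m k \<xi>) *\<^sub>v C k) UNIV))\<^sup>2) = frame_form (\<lambda>k i. C k $ i) \<xi>"
  unfolding frame_form_def
proof (rule sum.cong[OF refl])
  fix m
  define vs where "vs k = concat (map (\<lambda>j. [colA N r M W j m k \<xi>, colB N r M W j m k \<xi>]) [0..<P + 1])" for k
  have len: "length (vs k) = 2 * (P + 1)" for k unfolding vs_def by (rule length_concat_pairs)
  have vsAB: "vs k ! (2 * j) = colA N r M W j m k \<xi> \<and> vs k ! (2 * j + 1) = colB N r M W j m k \<xi>" if "j < P + 1" for j k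
    unfolding vs_def
    by (rule nth_concat_pairs[where f="\<lambda>j. colA N r M W j m k \<xi>" and g="\<lambda>j. colB N r M W j m k \<xi>", OF that])
  have "colA N r M W j m k \<xi> \<in> carrier_vec (4 * N)" "colB N r M W j m k \<xi> \<in> carrier_vec (4 * N)" for j k
    by (intro carrier_vecI; simp add: colA_def colB_def Let_def)+
  then have vs: "set (vs k) \<subseteq> carrier_vec (4 * N)" for k unfolding vs_def by auto
  define u where "u k = mat_adjoint (matM N r M P W m k \<xi>) *\<^sub>v C k" for k
  have u_eq: "u k = mat_adjoint (mat_of_cols (4 * N) (vs k)) *\<^sub>v C k" for k by (simp add: u_def matM_def vs_def)
  have u: "u k \<in> carrier_vec (2 * (P + 1))" for k
    unfolding u_eq using mat_adjoint_mat_of_cols_mult(2)[OF vs[of k] C[of k], of 0] len[of k]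
    by (intro carrier_vecI) simp
  have uA: "(\<Sum>k\<in>UNIV. u k $ (2 * j)) = column_form (\<lambda>k i. C k $ i) m j 0 \<xi>" if "j < P + 1" for j
  proof -
    have "u k $ (2 * j) = (\<Sum>i<4*N. C k $ i * cnj (w m j (\<xi> + \<sigma> i) $h k))" for k
      using that mat_adjoint_mat_of_cols_mult(1)[OF vs[of k] C[of k], of "2 * j"] len[of k]
      vsAB[OF that, of k] by (simp add: u_eq colA_index mult.commute)
    then have "(\<Sum>k\<in>UNIV. u k $ (2 * j)) = (\<Sum>k\<in>UNIV. \<Sum>i<4*N. C k $ i * cnj (w m j (\<xi> + \<sigma> i) $h k))" by simp
    also have "\<dots> = column_form (\<lambda>k i. C k $ i) m j 0 \<xi>"
      unfolding column_form_def by (subst sum.swap) simp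
    finally show ?thesis .
  qed
  have uB: "(\<Sum>k\<in>UNIV. u k $ (2 * j + 1)) = column_form (\<lambda>k i. C k $ i) m j 1 \<xi>" if "j < P + 1" for j
  proof -
    have "u k $ (2 * j + 1) = (\<Sum>i<4*N. C k $ i * cnj (w m j (\<xi> + \<sigma> i) $h k) * cis (- (4 * pi * of_int r * (\<xi> + \<sigma> i))))" for k
    proof -
      have "u k $ (2 * j + 1) = (\<Sum>i<4*N. cnj (colB N r M W j m k \<xi> $ i) * C k $ i)"
        using that mat_adjoint_mat_of_cols_mult(1)[OF vs[of k] C[of k], of "2 * j + 1"] len[of k] vsAB[OF that, of k]
        by (simp add: u_eq)
      also have "\<dots> = (\<Sum>i<4*N. C k $ i * cnj (w m j (\<xi> + \<sigma> i) $h k) * cis (- (4 * pi * of_int r * (\<xi> + \<sigma> i))))"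
        by (intro sum.cong refl) (simp add: colB_index[OF N] colA_index cis_cnj)
      finally show ?thesis .
    qed
    then have "(\<Sum>k\<in>UNIV. u k $ (2 * j + 1)) = (\<Sum>k\<in>UNIV. \<Sum>i<4*N. C k $ i * cnj (w m j (\<xi> + \<sigma> i) $h k) * cis (- (4 * pi * of_int r * (\<xi> + \<sigma> i))))" by simp
    also have "\<dots> = column_form (\<lambda>k i. C k $ i) m j 1 \<xi>"
      unfolding column_form_def by (subst sum.swap) (simp add: sum_distrib_right)
    finally show ?thesis .
  qed
  have idx: "finsum_vec TYPE(complex) (2 * (P + 1)) u UNIV $ a = (\<Sum>k\<in>UNIV. u k $ a)" if "a < 2 * (P + 1)" for a
    using u that by (intro index_finsum_vec) auto
  have "finsum_vec TYPE(complex) (2 * (P + 1)) u UNIV \<in> carrier_vec (2 * (P + 1))"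
    using u by (intro finsum_vec_closed) auto
  then have "(cvec_norm (finsum_vec TYPE(complex) (2 * (P + 1)) u UNIV))\<^sup>2 =
      (\<Sum>a<2 * (P + 1). (cmod (finsum_vec TYPE(complex) (2 * (P + 1)) u UNIV $ a))\<^sup>2)"
    unfolding cvec_norm_power2 by (simp only: carrier_vecD)
  also have "\<dots> = (\<Sum>a<2 * (P + 1). (cmod (\<Sum>k\<in>UNIV. u k $ a))\<^sup>2)"
    by (intro sum.cong refl) (simp only: idx lessThan_iff)
  also have "\<dots> = (\<Sum>j<P + 1. (cmod (column_form (\<lambda>k i. C k $ i) m j 0 \<xi>))\<^sup>2 + (cmod (column_form (\<lambda>k i. C k $ i) m j 1 \<xi>))\<^sup>2)"
    unfolding sum_lessThan_double by (intro sum.cong refl) (simp only: uA uB lessThan_iff)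
  also have "{..<P + 1} = {..P}" by auto
  finally show "(cvec_norm (finsum_vec TYPE(complex) (2 * (P + 1)) (\<lambda>k. mat_adjoint (matM N r M P W m k \<xi>) *\<^sub>v C k) UNIV))\<^sup>2 =
    (\<Sum>j\<le>P. (cmod (column_form (\<lambda>k i. C k $ i) m j 0 \<xi>))\<^sup>2 + (cmod (column_form (\<lambda>k i. C k $ i) m j 1 \<xi>))\<^sup>2)"
    by (simp only: u_def[abs_def])
qed

lemma mass_vec:
  assumes "\<And>k. C k \<in> carrier_vec (4 * N)"
  shows "(\<Sum>k\<in>UNIV. (cvec_norm (C k))\<^sup>2) = mass (\<lambda>k i. C k $ i)"
  unfolding mass_def cvec_norm_power2 carrier_vecD[OF assms] ..

text \<open>For fixed m and j the sum over l is given by \<open>folded_parseval\<close>. The sums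
  over m and j are finite and the terms nonnegative, so the triple family is summable.\<close>

lemma gabor_frame_sum:
  fixes Z :: "real \<Rightarrow> complex^'s"
  assumes F: "\<And>k. represents (F k) (\<lambda>l. Z l $h k)"
  shows "integrable (leb_on {0..<\<delta>}) (\<lambda>x. frame_form (\<lambda>k i. F k (x + \<sigma> i)) x)"
    and "((\<lambda>(m, j, l). (cmod (ell2_inner \<Lambda> Z (gabor_elem N M W m j l)))\<^sup>2) has_sum
      (\<delta> * (\<integral>x. frame_form (\<lambda>k i. F k (x + \<sigma> i)) x \<partial>leb_on {0..<\<delta>}))) ({..<M} \<times> {..P} \<times> \<Lambda>)"
proof -
  define q where "q m j x = (cmod (column_form (\<lambda>k i. F k (x + \<sigma> i)) m j 0 x))\<^sup>2 + (cmod (column_form (\<lambda>k i. F k (x + \<sigma> i)) m j 1 x))\<^sup>2" for m j x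
  have Fsq: "sq_integrable (leb_on (Omega N)) (F k)" for k using F by (simp add: represents_def)
  \<comment> \<open>A product of two square-integrable functions is in general only integrable; the
    bound \<open>B0\<close> on the transformed windows makes \<open>h\<close> square integrable, as
    Parseval requires.\<close>
  define h where "h m j x = (\<Sum>k\<in>UNIV. F k x * cnj (w m j x $h k))" for m j x
  have hsq: "sq_integrable (leb_on (Omega N)) (h m j)" if "m < M" "j \<le> P" for m j
    unfolding h_def
  proof (rule sq_integrable_sum)
    fix k
    have [measurable]: "w m j \<in> borel_measurable borel" by (rule w_measurable[OF that(2)])
    have "sq_integrable (leb_on (Omega N)) (\<lambda>x. cnj (w m j x $h k) * F k x)"
    proof (rule sq_integrable_mult_bounded[OF Fsq])
      show "(\<lambda>x. cnj (w m j x $h k)) \<in> borel_measurable (leb_on (Omega N))"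
        by (intro measurable_leb_on) measurable
      show "AE x in leb_on (Omega N). cmod (cnj (w m j x $h k)) \<le> B0"
        using bounded_fourier[OF that]
      proof eventually_elim
        case (elim x)
        then show ?case using Finite_Cartesian_Product.norm_nth_le[of "w m j x" k] by simp
      qed
    qed
    then show "sq_integrable (leb_on (Omega N)) (\<lambda>x. F k x * cnj (w m j x $h k))" by (simp add: mult.commute)
  qed
  have fold: "folded N r (h m j) b x = column_form (\<lambda>k i. F k (x + \<sigma> i)) m j b x" for m j b x
    by (simp add: folded_def column_form_def h_def)
  have qi: "integrable (leb_on {0..<\<delta>}) (q m j)" if "m < M" "j \<le> P" for m j
  proof -
    have "q m j = (\<lambda>x. (cmod (folded N r (h m j) 0 x))\<^sup>2 + (cmod (folded N r (h m j) 1 x))\<^sup>2)"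
      by (simp add: q_def fold fun_eq_iff)
    then show ?thesis
      using folded_parseval(2)[OF N r hsq[OF that], of 0] folded_parseval(2)[OF N r hsq[OF that], of 1]
      by (simp add: sq_integrable_def)
  qed
  show "integrable (leb_on {0..<\<delta>}) (\<lambda>x. frame_form (\<lambda>k i. F k (x + \<sigma> i)) x)"
    unfolding frame_form_def q_def[symmetric] using qi by (intro Bochner_Integration.integrable_sum) auto
  have one: "((\<lambda>l. (cmod (ell2_inner \<Lambda> Z (gabor_elem N M W m j l)))\<^sup>2) has_sum (\<delta> * (\<integral>x. q m j x \<partial>leb_on {0..<\<delta>}))) \<Lambda>"
    if "m < M" "j \<le> P" for m j
    using folded_parseval(1)[OF N r hsq[OF that]] gabor_coefficient[where W=W and j=j and F=F and Z=Z and M=M and m=m, OF N r W[OF that(2)] F]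
    unfolding q_def fold h_def by (simp cong: has_sum_cong)
  have "((\<lambda>(m, j, l). (cmod (ell2_inner \<Lambda> Z (gabor_elem N M W m j l)))\<^sup>2) has_sum
      (\<Sum>m<M. \<Sum>j\<le>P. \<delta> * (\<integral>x. q m j x \<partial>leb_on {0..<\<delta>}))) ({..<M} \<times> {..P} \<times> \<Lambda>)"
    by (intro has_sum_finite_Times one) auto
  also have "(\<Sum>m<M. \<Sum>j\<le>P. \<delta> * (\<integral>x. q m j x \<partial>leb_on {0..<\<delta>})) = \<delta> * (\<integral>x. frame_form (\<lambda>k i. F k (x + \<sigma> i)) x \<partial>leb_on {0..<\<delta>})"
  proof -
    have "(\<integral>x. (\<Sum>m<M. \<Sum>j\<le>P. q m j x) \<partial>leb_on {0..<\<delta>}) = (\<Sum>m<M. \<integral>x. (\<Sum>j\<le>P. q m j x) \<partial>leb_on {0..<\<delta>})"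
      by (intro Bochner_Integration.integral_sum Bochner_Integration.integrable_sum qi) auto
    also have "\<dots> = (\<Sum>m<M. \<Sum>j\<le>P. \<integral>x. q m j x \<partial>leb_on {0..<\<delta>})"
      by (intro sum.cong refl Bochner_Integration.integral_sum qi) auto
    finally show ?thesis
      unfolding frame_form_def q_def[symmetric] sum_distrib_left[symmetric] by (simp only:)
  qed
  finally show "((\<lambda>(m, j, l). (cmod (ell2_inner \<Lambda> Z (gabor_elem N M W m j l)))\<^sup>2) has_sum
      (\<delta> * (\<integral>x. frame_form (\<lambda>k i. F k (x + \<sigma> i)) x \<partial>leb_on {0..<\<delta>}))) ({..<M} \<times> {..P} \<times> \<Lambda>)" .
qed

text \<open>No factor \<delta> appears, the exponentials being orthonormal on
  \<open>Omega N\<close>; its presence in \<open>gabor_frame_sum\<close> produces the 4N of the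
  pointwise inequality.\<close>

lemma norm_mass:
  fixes Z :: "real \<Rightarrow> complex^'s"
  assumes F: "\<And>k. represents (F k) (\<lambda>l. Z l $h k)"
  shows "integrable (leb_on {0..<\<delta>}) (\<lambda>x. mass (\<lambda>k i. F k (x + \<sigma> i)))"
    and "(ell2_norm \<Lambda> Z)\<^sup>2 = (\<integral>x. mass (\<lambda>k i. F k (x + \<sigma> i)) \<partial>leb_on {0..<\<delta>})"
proof -
  have Fi: "integrable (leb_on (Omega N)) (\<lambda>x. (cmod (F k x))\<^sup>2)" for k
    using F by (simp add: represents_def sq_integrable_def)
  then have Fi': "integrable (leb_on {0..<\<delta>}) (\<lambda>x. \<Sum>i<4*N. (cmod (F k (x + \<sigma> i)))\<^sup>2)" for k
    using integrable_tiling[of "\<lambda>x. (cmod (F k x))\<^sup>2"] by (intro Bochner_Integration.integrable_sum) auto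
  then show "integrable (leb_on {0..<\<delta>}) (\<lambda>x. mass (\<lambda>k i. F k (x + \<sigma> i)))"
    unfolding mass_def by (rule Bochner_Integration.integrable_sum)
  show "(ell2_norm \<Lambda> Z)\<^sup>2 = (\<integral>x. mass (\<lambda>k i. F k (x + \<sigma> i)) \<partial>leb_on {0..<\<delta>})"
    unfolding ell2_norm_eq[OF F] integral_tiling[OF Fi] mass_def
    by (rule Bochner_Integration.integral_sum[symmetric]) (rule Fi')
qed

text \<open>Cauchy-Schwarz over the pairs (i, k); their number, 4N times S, is the extra
  factor.\<close>

lemma column_form_bound:
  assumes b: "\<And>i. i < 4*N \<Longrightarrow> norm (w m j (x + \<sigma> i)) \<le> B0"
  shows "(cmod (column_form c m j b x))\<^sup>2 \<le> B0\<^sup>2 * (real (CARD('s)) * (4 * real N)) * mass c"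
proof -
  have "cmod (column_form c m j b x) \<le> (\<Sum>i<4*N. \<Sum>k\<in>UNIV. cmod (c k i) * B0)"
    unfolding column_form_def
  proof (rule sum_norm_le)
    fix i assume "i \<in> {..<4*N}"
    then have "cmod (w m j (x + \<sigma> i) $h k) \<le> B0" for k
      using b[of i] Finite_Cartesian_Product.norm_nth_le[of "w m j (x + \<sigma> i)" k] by simp
    then have "cmod (\<Sum>k\<in>UNIV. c k i * cnj (w m j (x + \<sigma> i) $h k)) \<le> (\<Sum>k\<in>UNIV. cmod (c k i) * B0)"
      by (intro sum_norm_le) (auto simp: norm_mult intro!: mult_left_mono)
    then show "cmod ((\<Sum>k\<in>UNIV. c k i * cnj (w m j (x + \<sigma> i) $h k)) * cis (- (real b * (4 * pi * of_int r * (x + \<sigma> i)))))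
      \<le> (\<Sum>k\<in>UNIV. cmod (c k i) * B0)"
      by (simp add: norm_mult)
  qed
  then have "(cmod (column_form c m j b x))\<^sup>2 \<le> (\<Sum>i<4*N. \<Sum>k\<in>UNIV. cmod (c k i) * B0)\<^sup>2"
    by (intro power_mono) auto
  also have "\<dots> = (\<Sum>(i, k)\<in>{..<4*N} \<times> UNIV. cmod (c k i) * B0)\<^sup>2"
    by (simp add: sum.cartesian_product)
  also have "\<dots> = (\<Sum>p\<in>{..<4*N} \<times> UNIV. (case p of (i, k) \<Rightarrow> cmod (c k i)) * B0)\<^sup>2"
    by (simp add: case_prod_beta)
  also have "\<dots> \<le> (\<Sum>p\<in>{..<4*N} \<times> UNIV. (case p of (i, k) \<Rightarrow> cmod (c k i))\<^sup>2) * (\<Sum>p\<in>{..<4*N} \<times> (UNIV :: 's set). B0\<^sup>2)"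
    by (rule Cauchy_Schwarz_ineq_sum)
  also have "(\<Sum>p\<in>{..<4*N} \<times> UNIV. (case p of (i, k) \<Rightarrow> cmod (c k i))\<^sup>2) = mass c"
    unfolding mass_def by (subst sum.swap) (simp add: sum.cartesian_product case_prod_beta)
  also have "(\<Sum>p\<in>{..<4*N} \<times> (UNIV :: 's set). B0\<^sup>2) = B0\<^sup>2 * (real (CARD('s)) * (4 * real N))"
    by (simp add: card_cartesian_product)
  finally show ?thesis by (simp add: mult_ac)
qed

text \<open>The column bound counted M times for m, P + 1 times for j, and twice for the two
  cosets.\<close>

definition upper_bound :: real where
  "upper_bound = real M * (real (P + 1) * (2 * (B0\<^sup>2 * (real (CARD('s)) * (4 * real N)))))"

text \<open>The exceptional set concerns only the windows at finitely many shifts, so it serves all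
  \<open>c\<close> at once.\<close>

lemma frame_form_bound: "AE x in leb_on {0..<\<delta>}. \<forall>c. frame_form c x \<le> upper_bound * mass c"
proof -
  have "AE x in leb_on {0..<\<delta>}. \<forall>m\<in>{..<M}. \<forall>j\<in>{..P}. \<forall>i\<in>{..<4*N}. norm (w m j (x + \<sigma> i)) \<le> B0"
    using bounded_fourier unfolding AE_tiling by (simp add: AE_finite_all)
  then show ?thesis
  proof eventually_elim
    case (elim x)
    show ?case
    proof
      fix c
      let ?K = "B0\<^sup>2 * (real (CARD('s)) * (4 * real N)) * mass c"
      have "frame_form c x \<le> (\<Sum>m<M. \<Sum>j\<le>P. ?K + ?K)"
        unfolding frame_form_def using elim by (intro sum_mono add_mono column_form_bound) auto
      also have "\<dots> = upper_bound * mass c" by (simp add: upper_bound_def)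
      finally show "frame_form c x \<le> upper_bound * mass c" .
    qed
  qed
qed

lemma frame_form_measurable: "frame_form c \<in> borel_measurable borel"
proof -
  have "column_form c m j b \<in> borel_measurable borel" if "j \<le> P" for m j b
  proof -
    have [measurable]: "w m j \<in> borel_measurable borel" by (rule w_measurable[OF that])
    show ?thesis unfolding column_form_def by measurable
  qed
  then have [measurable]: "j \<in> {..P} \<Longrightarrow> column_form c m j b \<in> borel_measurable borel" for m j b by simp
  show ?thesis unfolding frame_form_def[abs_def] by measurable
qed

text \<open>The values 0 and 1 are their own squares, so a quadratic form scales with the indicator
  itself.\<close>

lemma frame_form_scale: "frame_form (\<lambda>k i. c k i * indicator E x) x = indicator E x * frame_form c x"
proof -
  have "column_form (\<lambda>k i. c k i * indicator E x) m j b x = indicator E x * column_form c m j b x" for m j b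
    by (cases "x \<in> E") (simp_all add: column_form_def)
  then show ?thesis
    by (cases "x \<in> E") (simp_all add: frame_form_def)
qed

lemma mass_scale: "mass (\<lambda>k i. c k i * indicator E x) = indicator E x * mass c"
  by (cases "x \<in> E") (simp_all add: mass_def)

section \<open>Passage between the integrated and the pointwise inequality\<close>

lemma frame_form_limit:
  assumes "\<And>k i. i < 4*N \<Longrightarrow> (\<lambda>n. q n k i) \<longlonglongrightarrow> c k i"
  shows "(\<lambda>n. frame_form (q n) x) \<longlonglongrightarrow> frame_form c x" "(\<lambda>n. mass (q n)) \<longlonglongrightarrow> mass c"
  unfolding frame_form_def column_form_def mass_def using assms by (auto intro!: tendsto_intros)

text \<open>A countable dense set of coefficients moves the quantifier over \<open>c\<close> inside \<open>AE\<close>.\<close>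

lemma AE_all_coefficients:
  assumes "\<And>c. AE x in A. a * mass c \<le> frame_form c x"
  shows "AE x in A. \<forall>c. a * mass c \<le> frame_form c x"
proof -
  obtain Q :: "complex set" where Q: "countable Q" "\<And>X. open X \<Longrightarrow> X \<noteq> {} \<Longrightarrow> \<exists>d\<in>Q. d \<in> X"
    by (rule countable_dense_setE) blast
  \<comment> \<open>Only finitely many coordinates (k, i) occur, so the functions with values in the
    countable dense set form a countable family.\<close>
  define D where "D = ((UNIV :: 's set) \<times> {..<4*N}) \<rightarrow>\<^sub>E Q"
  have "countable D"
    unfolding D_def using Q(1) by (intro countable_PiE) auto
  then have "AE x in A. \<forall>q\<in>D. a * mass (curry q) \<le> frame_form (curry q) x"
    using assms by (subst AE_ball_countable) auto
  then show ?thesis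
  proof eventually_elim
    case (elim x)
    show ?case
    proof
      fix c :: "'s \<Rightarrow> nat \<Rightarrow> complex"
      define d where "d n k i = (SOME z. z \<in> Q \<and> dist (c k i) z < inverse (real (Suc n)))" for n k i
      have "\<exists>z\<in>Q. z \<in> ball (c k i) (inverse (real (Suc n)))" for n k i
        by (rule Q(2)) auto
      then have "\<exists>z. z \<in> Q \<and> dist (c k i) z < inverse (real (Suc n))" for n k i
        by (simp only: Bex_def mem_ball)
      from someI_ex[OF this] have d: "d n k i \<in> Q" "dist (c k i) (d n k i) < inverse (real (Suc n))" for n k i
        unfolding d_def by auto
      define q where "q n = restrict (\<lambda>(k, i). d n k i) (UNIV \<times> {..<4*N})" for n
      have qD: "q n \<in> D" for n unfolding D_def q_def using d(1) by auto
      have "(\<lambda>n. curry (q n) k i) \<longlonglongrightarrow> c k i" if "i < 4*N" for k i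
      proof (rule metric_tendsto_imp_tendsto[OF LIMSEQ_inverse_real_of_nat])
        show "\<forall>\<^sub>F n in sequentially. dist (curry (q n) k i) (c k i) \<le> dist (inverse (real (Suc n))) 0"
          using d(2)[of k i] that by (intro always_eventually) (simp add: q_def dist_commute less_imp_le)
      qed
      note lim = frame_form_limit[of "\<lambda>n. curry (q n)", OF this]
      show "a * mass c \<le> frame_form c x"
        by (rule LIMSEQ_le[OF tendsto_mult[OF tendsto_const lim(2)] lim(1)]) (use elim qD in auto)
    qed
  qed
qed

text \<open>The coefficients \<open>F k (x + \<sigma> i)\<close> vary with x, so the pointwise
  inequality must hold for all \<open>c\<close> off a single null set. The maximum in the upper
  bound secures that it is at least \<open>A0\<close>.\<close>

lemma frame_if_form_ge:
  assumes A0: "A0 > 0" and ge: "AE x in leb_on {0..<\<delta>}. \<forall>c. 4 * real N * A0 * mass c \<le> frame_form c x"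
  shows "dvnug_frame N r M P W A0 (max A0 (\<delta> * upper_bound))"
  unfolding dvnug_frame_def
proof (intro conjI ballI)
  fix Z :: "real \<Rightarrow> complex^'s" assume Z: "Z \<in> ell2 \<Lambda>"
  define F where "F k x = fourier \<Lambda> (Omega N) Z x $h k" for k x
  have F: "represents (F k) (\<lambda>l. Z l $h k)" for k
    unfolding F_def by (rule fourier_properties[OF Z])
  note fs = gabor_frame_sum[OF F] and nm = norm_mass[OF F]
  have \<delta>: "\<delta> > 0" "4 * real N * \<delta> = 1" using N by auto
  show "(\<lambda>(m, j, l). (cmod (ell2_inner \<Lambda> Z (gabor_elem N M W m j l)))\<^sup>2) summable_on {..<M} \<times> {..P} \<times> \<Lambda>"
    using fs(2) by (rule has_sum_imp_summable)
  have inf: "(\<Sum>\<^sub>\<infinity>(m, j, l)\<in>{..<M} \<times> {..P} \<times> \<Lambda>. (cmod (ell2_inner \<Lambda> Z (gabor_elem N M W m j l)))\<^sup>2)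
    = \<delta> * (\<integral>x. frame_form (\<lambda>k i. F k (x + \<sigma> i)) x \<partial>leb_on {0..<\<delta>})"
    using fs(2) by (rule infsumI)
  have "A0 * (ell2_norm \<Lambda> Z)\<^sup>2 = \<delta> * (\<integral>x. 4 * real N * A0 * mass (\<lambda>k i. F k (x + \<sigma> i)) \<partial>leb_on {0..<\<delta>})"
    using \<delta> N unfolding nm(2) by simp
  also have "\<dots> \<le> \<delta> * (\<integral>x. frame_form (\<lambda>k i. F k (x + \<sigma> i)) x \<partial>leb_on {0..<\<delta>})"
    using \<delta> nm(1) fs(1) ge by (intro mult_left_mono integral_mono_AE) auto
  finally show "A0 * (ell2_norm \<Lambda> Z)\<^sup>2 \<le> (\<Sum>\<^sub>\<infinity>(m, j, l)\<in>{..<M} \<times> {..P} \<times> \<Lambda>. (cmod (ell2_inner \<Lambda> Z (gabor_elem N M W m j l)))\<^sup>2)"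
    unfolding inf .
  have "\<delta> * (\<integral>x. frame_form (\<lambda>k i. F k (x + \<sigma> i)) x \<partial>leb_on {0..<\<delta>}) \<le> \<delta> * (\<integral>x. upper_bound * mass (\<lambda>k i. F k (x + \<sigma> i)) \<partial>leb_on {0..<\<delta>})"
    using \<delta> nm(1) fs(1) frame_form_bound by (intro mult_left_mono integral_mono_AE) auto
  also have "\<dots> = (\<delta> * upper_bound) * (ell2_norm \<Lambda> Z)\<^sup>2"
    unfolding nm(2) by simp
  also have "\<dots> \<le> max A0 (\<delta> * upper_bound) * (ell2_norm \<Lambda> Z)\<^sup>2"
    by (intro mult_right_mono) auto
  finally show "(\<Sum>\<^sub>\<infinity>(m, j, l)\<in>{..<M} \<times> {..P} \<times> \<Lambda>. (cmod (ell2_inner \<Lambda> Z (gabor_elem N M W m j l)))\<^sup>2) \<le> max A0 (\<delta> * upper_bound) * (ell2_norm \<Lambda> Z)\<^sup>2"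
    unfolding inf .
qed (use A0 in auto)

text \<open>Test the frame inequality on the sequence whose Fourier transform has the constant coefficients \<open>c\<close>
  over the exceptional set \<open>E\<close> of the pointwise inequality and vanishes elsewhere.\<close>

lemma form_ge_if_frame:
  assumes frame: "dvnug_frame N r M P W A0 \<beta>"
  shows "AE x in leb_on {0..<\<delta>}. 4 * real N * A0 * mass c \<le> frame_form c x"
proof -
  define a where "a = 4 * real N * A0 * mass c"
  define E where "E = {x \<in> {0..<\<delta>}. frame_form c x < a}"
  have [measurable]: "frame_form c \<in> borel_measurable borel" by (rule frame_form_measurable)
  have E[measurable]: "E \<in> sets borel" unfolding E_def by measurable
  \<comment> \<open>A copy of \<open>E\<close>, weighted by \<open>c k i\<close>, is placed on each
    tile; the coefficient vectors of \<open>g\<close> over x are then \<open>c\<close> for x in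
    \<open>E\<close> and 0 otherwise.\<close>
  define g where "g k y = (\<Sum>i<4*N. c k i * indicator E (y - \<sigma> i))" for k y
  have [measurable]: "g k \<in> borel_measurable borel" for k unfolding g_def by measurable
  have g_shift: "g k (x + \<sigma> i) = c k i * indicator E x" if "i < 4*N" "x \<in> {0..<\<delta>}" for k x i
  proof -
    have "indicator E (x + \<sigma> i - \<sigma> i') = (0::complex)" if "i' < 4*N" "i' \<noteq> i" for i'
    proof (rule ccontr)
      assume "indicator E (x + \<sigma> i - \<sigma> i') \<noteq> (0::complex)"
      then have "x + \<sigma> i - \<sigma> i' \<in> {0..<\<delta>}" by (auto simp: E_def indicator_def split: if_splits)
      then have "x + \<sigma> i \<in> {\<sigma> i..<\<sigma> i + \<delta>} \<inter> {\<sigma> i'..<\<sigma> i' + \<delta>}"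
        using \<open>x \<in> {0..<\<delta>}\<close> by auto
      then show False using disj[of i i'] that \<open>i < 4*N\<close> by auto
    qed
    then have "g k (x + \<sigma> i) = (\<Sum>i'<4*N. if i' = i then c k i * indicator E x else 0)"
      unfolding g_def by (intro sum.cong) auto
    then show ?thesis using that by simp
  qed
  interpret finite_measure "leb_on (Omega N)" by (intro finite_measure_leb_on bounded_Omega) auto
  have gsq: "sq_integrable (leb_on (Omega N)) (g k)" for k
  proof -
    have one: "sq_integrable (leb_on (Omega N)) (\<lambda>x. 1)" by (simp add: sq_integrable_def)
    have "cmod (g k x) \<le> (\<Sum>i<4*N. cmod (c k i))" for x
      unfolding g_def by (intro sum_norm_le) (auto simp: norm_mult indicator_def)
    then have "sq_integrable (leb_on (Omega N)) (\<lambda>x. g k x * 1)"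
      by (intro sq_integrable_mult_bounded[OF one, where K="\<Sum>i<4*N. cmod (c k i)"] measurable_leb_on AE_I2) auto
    then show ?thesis by simp
  qed
  define Z :: "real \<Rightarrow> complex^'s" where
    \<comment> \<open>The Fourier coefficients of \<open>g\<close>; by completeness \<open>g\<close>
      represents this sequence, so the frame inequality becomes an inequality of integrals over
      \<open>E\<close>.\<close>
    "Z l = vec_lambda (\<lambda>k. \<integral>x. g k x * cnj (cis (2 * pi * l * x)) \<partial>leb_on (Omega N))" for l
  have F: "represents (g k) (\<lambda>l. Z l $h k)" for k
    by (rule represents_expansion[OF gsq]) (simp add: Z_def)
  have "((\<lambda>l. (cmod (Z l $h k))\<^sup>2) has_sum infsum (\<lambda>l. (cmod (Z l $h k))\<^sup>2) \<Lambda>) \<Lambda>" for k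
    using bessel[OF gsq[of k]] by (simp add: Z_def)
  then have Z: "Z \<in> ell2 \<Lambda>"
    unfolding ell2_def mem_Collect_eq by (intro has_sum_imp_summable[OF has_sum_sum_finite]) auto
  note fs = gabor_frame_sum[OF F] and nm = norm_mass[OF F]
  have on: "x \<in> space (leb_on {0..<\<delta>}) \<longleftrightarrow> x \<in> {0..<\<delta>}" for x by (simp add: space_restrict_space)
  have ff: "frame_form (\<lambda>k i. g k (x + \<sigma> i)) x = indicator E x * frame_form c x"
    and mm: "mass (\<lambda>k i. g k (x + \<sigma> i)) = indicator E x * mass c" if "x \<in> space (leb_on {0..<\<delta>})" for x
  proof -
    have g: "i < 4*N \<Longrightarrow> g k (x + \<sigma> i) = c k i * indicator E x" for k i
      using that g_shift unfolding on by blast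
    then have "frame_form (\<lambda>k i. g k (x + \<sigma> i)) x = frame_form (\<lambda>k i. c k i * indicator E x) x"
      by (rule frame_form_cong)
    then show "frame_form (\<lambda>k i. g k (x + \<sigma> i)) x = indicator E x * frame_form c x"
      by (simp only: frame_form_scale)
    have "mass (\<lambda>k i. g k (x + \<sigma> i)) = mass (\<lambda>k i. c k i * indicator E x)"
      using g by (rule mass_cong)
    then show "mass (\<lambda>k i. g k (x + \<sigma> i)) = indicator E x * mass c"
      by (simp only: mass_scale)
  qed
  have i1: "integrable (leb_on {0..<\<delta>}) (\<lambda>x. indicator E x * frame_form c x)"
    by (rule iffD1[OF Bochner_Integration.integrable_cong[OF refl ff] fs(1)])
  have i2: "integrable (leb_on {0..<\<delta>}) (\<lambda>x. indicator E x * mass c)"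
    by (rule iffD1[OF Bochner_Integration.integrable_cong[OF refl mm] nm(1)])
  have "A0 * (ell2_norm \<Lambda> Z)\<^sup>2 \<le> (\<Sum>\<^sub>\<infinity>(m, j, l)\<in>{..<M} \<times> {..P} \<times> \<Lambda>. (cmod (ell2_inner \<Lambda> Z (gabor_elem N M W m j l)))\<^sup>2)"
    using frame Z unfolding dvnug_frame_def by blast
  also note infsumI[OF fs(2)]
  also have "(\<integral>x. frame_form (\<lambda>k i. g k (x + \<sigma> i)) x \<partial>leb_on {0..<\<delta>}) = (\<integral>x. indicator E x * frame_form c x \<partial>leb_on {0..<\<delta>})"
    by (rule Bochner_Integration.integral_cong[OF refl ff])
  also have "(ell2_norm \<Lambda> Z)\<^sup>2 = (\<integral>x. indicator E x * mass c \<partial>leb_on {0..<\<delta>})"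
    unfolding nm(2) by (rule Bochner_Integration.integral_cong[OF refl mm])
  finally have "4 * real N * A0 * (\<integral>x. indicator E x * mass c \<partial>leb_on {0..<\<delta>}) \<le> (\<integral>x. indicator E x * frame_form c x \<partial>leb_on {0..<\<delta>})"
    using N by (simp add: field_simps)
  moreover have i3: "integrable (leb_on {0..<\<delta>}) (\<lambda>x. 4 * real N * A0 * (indicator E x * mass c) - indicator E x * frame_form c x)"
    using i1 i2 by (intro Bochner_Integration.integrable_diff integrable_mult_right)
  ultimately have le0: "(\<integral>x. 4 * real N * A0 * (indicator E x * mass c) - indicator E x * frame_form c x \<partial>leb_on {0..<\<delta>}) \<le> 0"
    using i1 i2 by simp
  \<comment> \<open>The integrand is strictly positive on \<open>E\<close> and 0 elsewhere, while
    its integral is at most 0; hence \<open>E\<close> is a null set.\<close>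
  have nonneg: "0 \<le> 4 * real N * A0 * (indicator E x * mass c) - indicator E x * frame_form c x" for x
    by (auto simp: indicator_def E_def a_def)
  have "0 \<le> (\<integral>x. 4 * real N * A0 * (indicator E x * mass c) - indicator E x * frame_form c x \<partial>leb_on {0..<\<delta>})"
    by (rule Bochner_Integration.integral_nonneg) (rule nonneg)
  with le0 have "AE x in leb_on {0..<\<delta>}. 4 * real N * A0 * (indicator E x * mass c) - indicator E x * frame_form c x = 0"
    by (intro iffD1[OF integral_nonneg_eq_0_iff_AE[OF i3 AE_I2[OF nonneg]]] antisym)
  moreover have "AE x in leb_on {0..<\<delta>}. x \<in> {0..<\<delta>}"
    using AE_space[of "leb_on {0..<\<delta>}"] unfolding on .
  ultimately show ?thesis
  proof eventually_elim
    case (elim x)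
    then have "x \<notin> E" by (auto simp: E_def a_def)
    then show ?case using elim(2) by (auto simp: E_def a_def)
  qed
qed

lemma frame_iff:
  assumes "A0 > 0"
  shows "(\<exists>\<beta>. dvnug_frame N r M P W A0 \<beta>) \<longleftrightarrow>
    (\<forall>c. AE x in leb_on {0..<\<delta>}. 4 * real N * A0 * mass c \<le> frame_form c x)"
  using form_ge_if_frame frame_if_form_ge[OF assms AE_all_coefficients] by blast

end

theorem theorem3p9:
  fixes N M P :: nat and r :: int and W :: "nat \<Rightarrow> real \<Rightarrow> complex^'s::finite" and A0 B0 :: real
  assumes "N \<ge> 1" and "M \<ge> 1"
    and "odd r" and "coprime r (int N)" and "1 \<le> r" and "r \<le> 2 * int N - 1"
    and "\<And>j. j \<in> {..P} \<Longrightarrow> W j \<in> ell2 (Lam N r)"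
    and "B0 > 0"
    and "\<And>m j. m \<in> {..<M} \<Longrightarrow> j \<in> {..P} \<Longrightarrow>
           AE \<xi>\<in>Omega N in lborel.
             norm (fourier (Lam N r) (Omega N) (modulation_op (real m / real M) (W j)) \<xi>) \<le> B0"
    and "A0 > 0"
  shows "(\<exists>\<beta>. dvnug_frame N r M P W A0 \<beta>) \<longleftrightarrow>
    (\<forall>C :: 's \<Rightarrow> complex Matrix.vec. (\<forall>k. C k \<in> carrier_vec (4 * N)) \<longrightarrow>
       (AE \<xi>\<in>{0<..<1 / (4 * real N)} in lborel.
          (\<Sum>m\<in>{..<M}. (cvec_norm (finsum_vec TYPE(complex) (2 * (P + 1))
               (\<lambda>k. mat_adjoint (matM N r M P W m k \<xi>) *\<^sub>v C k) UNIV))\<^sup>2)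
          \<ge> 4 * real N * A0 * (\<Sum>k\<in>UNIV. (cvec_norm (C k))\<^sup>2)))"
proof -
  interpret gabor_setting N M P r W B0
    by unfold_locales (use assms in \<open>auto simp: AE_restrict_space_iff\<close>)
  \<comment> \<open>The open and half-open intervals differ by the null set {0}.\<close>
  have open_iff: "(AE x\<in>{0<..<\<delta>} in lborel. p x) \<longleftrightarrow> (AE x in leb_on {0..<\<delta>}. p x)" for p
  proof -
    have "AE x in lborel. (x \<in> {0<..<\<delta>} \<longrightarrow> p x) \<longleftrightarrow> (x \<in> {0..<\<delta>} \<longrightarrow> p x)"
      using AE_lborel_singleton[of 0] by eventually_elim (auto simp: order_le_less)
    then have "(AE x\<in>{0<..<\<delta>} in lborel. p x) \<longleftrightarrow> (AE x\<in>{0..<\<delta>} in lborel. p x)"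
      by (rule eventually_subst)
    then show ?thesis by (simp add: AE_restrict_space_iff)
  qed
  have "(\<forall>C. (\<forall>k. C k \<in> carrier_vec (4 * N)) \<longrightarrow>
       (AE x in leb_on {0..<\<delta>}. 4 * real N * A0 * mass (\<lambda>k i. C k $ i) \<le> frame_form (\<lambda>k i. C k $ i) x)) \<longleftrightarrow>
     (\<forall>c. AE x in leb_on {0..<\<delta>}. 4 * real N * A0 * mass c \<le> frame_form c x)" (is "?L \<longleftrightarrow> ?R")
  proof
    assume L: ?L
    show ?R
    proof
      fix c
      \<comment> \<open>A vector has no meaningful entries beyond its dimension, while
        \<open>c k\<close> is defined on all naturals; the congruence rules discard both
        tails.\<close>
      have "mass (\<lambda>k i. Matrix.vec (4 * N) (c k) $ i) = mass c"
        "frame_form (\<lambda>k i. Matrix.vec (4 * N) (c k) $ i) x = frame_form c x" for x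
        by (auto intro!: mass_cong frame_form_cong)
      with L[rule_format, of "\<lambda>k. Matrix.vec (4 * N) (c k)"]
      show "AE x in leb_on {0..<\<delta>}. 4 * real N * A0 * mass c \<le> frame_form c x" by simp
    qed
  qed blast
  then show ?thesis
    unfolding open_iff frame_iff[OF \<open>A0 > 0\<close>] by (simp only: frame_form_matM mass_vec cong: imp_cong)
qed

end
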